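(* If $G$ is a nontrivial finite $Z$-group, then $\operatorname{diam}(\Delta(G))\le 2$ if and only if $\mathbf{Z}(G)\neq\{1\}$.
   Context: A $Z$-group is a group in which every Sylow subgroup is cyclic. For a group $G$, the cyclic graph $\Delta(G)$ is the simple graph whose vertex set is $G^{\#}=G\setminus\{1\}$, with an edge between distinct vertices $x,y$ if and only if the subgroup $\langle x,y\rangle$ is cyclic. $\mathbf{Z}(G)$ denotes the center of $G$. The condition $\operatorname{diam}(\Delta(G))\le 2$ means that any two vertices are joined by a path of length at most $2$ (a disconnected graph has infinite diameter). *)

theory Defs
  imports
    "HOL-Algebra.Elementary_Groups"
    "HOL-Computational_Algebra.Primes"
    "Graph_Theory.Pair_Digraph"
    "Graph_Theory.Shortest_Path"
begin

text \<open>
  The order of a Sylow \<open>p\<close>-subgroup is the full \<open>p\<close>-part of \<open>order G\<close>. If \<open>p\<close> does not divide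
  \<open>order G\<close> this is the trivial subgroup, which is harmless below because it is cyclic. The
  definition is meaningful for finite groups only: \<open>order G = 0\<close> if \<open>G\<close> is infinite.
\<close>
definition sylow_subgroup :: "nat \<Rightarrow> 'a set \<Rightarrow> ('a, 'b) monoid_scheme \<Rightarrow> bool" where
  "sylow_subgroup p P G \<longleftrightarrow>
     prime p \<and> subgroup P G \<and> card P = p ^ multiplicity p (order G)"

definition Z_group :: "('a, 'b) monoid_scheme \<Rightarrow> bool" where
  "Z_group G \<longleftrightarrow>
     group G \<and> (\<forall>p P. sylow_subgroup p P G \<longrightarrow> cyclic_group (G\<lparr>carrier := P\<rparr>))"

definition center :: "('a, 'b) monoid_scheme \<Rightarrow> 'a set" where
  "center G = {z \<in> carrier G. \<forall>g \<in> carrier G. z \<otimes>\<^bsub>G\<^esub> g = g \<otimes>\<^bsub>G\<^esub> z}"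

text \<open>As usual in \<^theory>\<open>Graph_Theory.Digraph\<close>, a simple graph is a symmetric loop-free digraph.\<close>
definition cyclic_graph :: "('a, 'b) monoid_scheme \<Rightarrow> 'a pair_pre_digraph" where
  "cyclic_graph G =
     \<lparr> pverts = carrier G - {\<one>\<^bsub>G\<^esub>},
       parcs = {(x, y). x \<in> carrier G - {\<one>\<^bsub>G\<^esub>} \<and> y \<in> carrier G - {\<one>\<^bsub>G\<^esub>} \<and> x \<noteq> y \<and>
                        cyclic_group (subgroup_generated G {x, y})} \<rparr>"

lemma pair_graph_cyclic_graph:
  assumes "finite (carrier G)"
  shows "pair_graph (cyclic_graph G)"
proof
  have "parcs (cyclic_graph G) \<subseteq> carrier G \<times> carrier G"
    by (auto simp: cyclic_graph_def)
  then show "finite (parcs (cyclic_graph G))"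
    using assms finite_subset by blast
  show "symmetric (with_proj (cyclic_graph G))"
    by (auto simp: symmetric_def cyclic_graph_def sym_def insert_commute)
qed (use assms in \<open>auto simp: cyclic_graph_def\<close>)

text \<open>
  With all arcs of weight 1, \<open>wf_digraph.\<mu>\<close> is the usual distance, the minimal length of a walk; it
  is \<open>\<infinity>\<close> if there is no walk.
\<close>
definition diameter :: "('a, 'b) pre_digraph \<Rightarrow> ereal" where
  "diameter H = (SUP u \<in> verts H. SUP v \<in> verts H. wf_digraph.\<mu> H (\<lambda>_. 1) u v)"

lemma diameter_le_iff:
  assumes "wf_digraph H"
  shows "diameter H \<le> ereal (real n) \<longleftrightarrow>
    (\<forall>u \<in> verts H. \<forall>v \<in> verts H. \<exists>p. pre_digraph.apath H u p v \<and> length p \<le> n)"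
proof -
  interpret wf_digraph H by fact
  have cost: "awalk_cost (\<lambda>_. 1) p = real (length p)" for p
    by (induct p) auto
  have "\<mu> (\<lambda>_. 1) u v \<le> ereal (real n) \<longleftrightarrow> (\<exists>p. apath u p v \<and> length p \<le> n)" for u v
  proof
    assume "\<mu> (\<lambda>_. 1) u v \<le> ereal (real n)"
    also have "ereal (real n) < ereal (real n + 1)" by simp
    finally obtain p where p: "awalk u p v" "length p \<le> n"
      unfolding \<mu>_def by (auto simp: INF_less_iff cost)
    have "length (awalk_to_apath p) \<le> length p"
      using p(1)
    proof (induct rule: awalk_to_apath_induct)
      case (path p)
      then show ?case by (auto simp: awalk_to_apath.simps)
    next
      case (decomp p q r s)
      then show ?case
        using step_awalk_to_apath[of u p v q r s] by (auto elim!: awalk_cyc_decompE)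
    qed
    then show "\<exists>p. apath u p v \<and> length p \<le> n"
      using p apath_awalk_to_apath by (meson order_trans)
  next
    assume "\<exists>p. apath u p v \<and> length p \<le> n"
    then obtain p where "awalk u p v" "length p \<le> n"
      by (auto simp: apath_def)
    then show "\<mu> (\<lambda>_. 1) u v \<le> ereal (real n)"
      using min_cost_le_walk_cost[of u p v "\<lambda>_. 1"] by (auto simp: cost intro: order_trans)
  qed
  then show ?thesis
    by (simp add: diameter_def SUP_le_iff)
qed

end

theory Submission
  imports
    Defs
    "HOL-Algebra.Multiplicative_Group"
    "HOL-Algebra.Sylow"
    "HOL-Number_Theory.Totient"
begin

text \<open>
  Write \<open>\<langle>x, y\<rangle>\<close> for the subgroup generated by \<open>x\<close> and \<open>y\<close>.

  \<^bold>\<open>A central element makes the diameter at most 2.\<close> Take \<open>z\<close> central of prime order \<open>p\<close>. Every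
  element \<open>w\<close> forms a cyclic group with \<open>z\<close> (\<open>cyclic_with_central_prime_order\<close>). If \<open>p\<close> does not
  divide the order of \<open>w\<close>, then \<open>w\<close> and \<open>z\<close> are commuting elements of coprime orders. Otherwise some
  power of \<open>w\<close> has order \<open>p\<close>; since the Sylow \<open>p\<close>-subgroups are cyclic and conjugate, all subgroups
  of order \<open>p\<close> are conjugate, hence equal to the central one \<open>\<langle>z\<rangle>\<close>, so \<open>z\<close> is a power of \<open>w\<close>. So
  \<open>z\<close> is adjacent to all other vertices.

  \<^bold>\<open>Diameter at most 2 gives a central element.\<close> A finite \<open>Z\<close>-group is generated by two
  elements \<open>x\<close> and \<open>y\<close> (\<open>two_generators\<close>). If both are nontrivial, a path of length at most 2
  between them contains a nontrivial element that commutes with both ends, and such an element is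
  central; otherwise the group is cyclic.

  The substance is therefore that two generators suffice. Choose a normal cyclic subgroup \<open>\<langle>x\<rangle>\<close> of
  largest possible order. It turns out to be its own centralizer
  (\<open>self_centralizing_normal_cyclic\<close>). The automorphisms of a cyclic group commute, so all
  commutators centralize \<open>x\<close> and thus lie in \<open>\<langle>x\<rangle>\<close>; the quotient by \<open>\<langle>x\<rangle>\<close> is an abelian group
  with cyclic Sylow subgroups, so it is cyclic, and \<open>y\<close> lifts a generator.

  That \<open>\<langle>x\<rangle>\<close> is its own centralizer is usually derived from solvability, hence from transfer. Here
  it comes from a counting argument of Frobenius (\<open>card_roots_top_factor\<close>): if \<open>H\<close> is a subgroup and
  \<open>card H = m * t\<close>, where no prime factor of \<open>t\<close> exceeds a prime factor of \<open>m\<close>, then \<open>x [^] m = \<one>\<close> has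
  exactly \<open>m\<close> solutions in \<open>H\<close>. If these solutions include an element of order \<open>m\<close>, then they are its
  powers, and so form a cyclic subgroup that every automorphism of \<open>H\<close> preserves. Applied to the
  centralizer of \<open>x\<close>, this would enlarge \<open>\<langle>x\<rangle>\<close> whenever the centralizer is larger than \<open>\<langle>x\<rangle>\<close>.

  The count descends from \<open>m * p\<close> to \<open>m\<close>, where \<open>p\<close> is the largest prime factor of \<open>t\<close>. Both \<open>m\<close> and
  \<open>p - 1\<close> divide the number of solutions that get lost, by grouping them into generators of cyclic
  subgroups, and by splitting each one into its \<open>p\<close>-part and a root in the centralizer of that
  \<open>p\<close>-part. As \<open>m\<close> and \<open>p - 1\<close> are coprime, this pins down the number. The induction runs
  over subgroups only: a \<open>p\<close>-part whose centralizer is all of \<open>H\<close> is treated directly, by the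
  conjugacy of the cyclic \<open>p\<close>-subgroups, instead of passing to a quotient.
\<close>

section \<open>Arithmetic and counting\<close>

lemma prime_power_dvdE:
  fixes p :: nat
  assumes "prime p" "d dvd p ^ n"
  obtains i where "i \<le> n" "d = p ^ i"
  using assms divides_primepow_nat by blast

lemma prime_not_dvd_div_prime_part:
  assumes "prime (p::nat)" "n > 0"
  shows "\<not> p dvd n div p ^ multiplicity p n"
  using assms multiplicity_decompose[of n p] by (auto simp: prime_gt_1_nat dest: prime_gt_1_nat)

lemma largest_prime_divisor:
  fixes t :: nat
  assumes "t \<noteq> 1" "t > 0"
  obtains p where "prime p" "p dvd t" "\<And>r. \<lbrakk>prime r; r dvd t\<rbrakk> \<Longrightarrow> r \<le> p"
proof -
  let ?A = "{r. prime r \<and> r dvd t}"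
  have fin: "finite ?A"
    by (rule finite_subset[of _ "{..t}"]) (use assms(2) in \<open>auto intro: dvd_imp_le\<close>)
  moreover have "?A \<noteq> {}" using prime_factor_nat[OF assms(1)] by blast
  ultimately have "Max ?A \<in> ?A" by (rule Max_in)
  then show ?thesis using that[of "Max ?A"] Max_ge[OF fin] by blast
qed

lemma div_gcd_dvd_cofactor:
  fixes c :: nat
  assumes "c dvd s * t" "s > 0"
  shows "c div gcd s c dvd t"
proof -
  define g where "g = gcd s c"
  have g: "g > 0" "s = g * (s div g)" "c = g * (c div g)" using assms(2) by (simp_all add: g_def)
  have "g * (c div g) dvd g * ((s div g) * t)"
    using assms(1) g by (metis mult.assoc)
  then have "c div g dvd (s div g) * t" using g(1) by simp
  moreover have "coprime (c div g) (s div g)"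
    using div_gcd_coprime[of s c] assms(2) by (simp add: g_def coprime_commute)
  ultimately show ?thesis by (simp add: coprime_dvd_mult_right_iff g_def)
qed

lemma coprime_natI:
  assumes "\<And>r::nat. \<lbrakk>prime r; r dvd a; r dvd b\<rbrakk> \<Longrightarrow> False"
  shows "coprime a b"
proof (rule ccontr)
  assume "\<not> coprime a b"
  then have "gcd a b \<noteq> 1" by (simp add: coprime_iff_gcd_eq_1)
  then obtain r where "prime r" "r dvd gcd a b" using prime_factor_nat by blast
  then show False using assms[of r] by simp
qed

lemma split_at_prime:
  fixes q :: nat
  assumes "prime q" "n > 0"
  obtains s b t where "n = s * q ^ b * t" "s > 0" "t > 0"
    "\<And>r. \<lbrakk>prime r; r dvd s\<rbrakk> \<Longrightarrow> q < r" "\<And>r. \<lbrakk>prime r; r dvd t\<rbrakk> \<Longrightarrow> r < q"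
  using assms(2)
proof (induction n arbitrary: thesis rule: less_induct)
  case (less n)
  show ?case
  proof (cases "n = 1")
    case True
    show ?thesis by (rule less.prems(1)[of 1 0 1]) (use True in auto)
  next
    case False
    then obtain r n' where r: "prime r" "n = r * n'" using prime_factor_nat by (metis dvdE)
    have "n' < n" "n' > 0" using r less.prems(2) prime_gt_1_nat[OF r(1)] by auto
    then obtain s b t where IH: "n' = s * q ^ b * t" "s > 0" "t > 0"
      "\<And>r. \<lbrakk>prime r; r dvd s\<rbrakk> \<Longrightarrow> q < r" "\<And>r. \<lbrakk>prime r; r dvd t\<rbrakk> \<Longrightarrow> r < q"
      using less.IH by blast
    consider "r < q" | "r = q" | "q < r" by linarith
    then show ?thesis
    proof cases
      case 1
      show ?thesis
        by (rule less.prems(1)[of s b "r * t"])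
          (use 1 r IH prime_gt_0_nat[OF r(1)] in \<open>auto simp: prime_dvd_mult_iff dest: primes_dvd_imp_eq\<close>)
    next
      case 2
      show ?thesis
        by (rule less.prems(1)[of s "Suc b" t]) (use 2 r IH in auto)
    next
      case 3
      show ?thesis
        by (rule less.prems(1)[of "r * s" b t])
          (use 3 r IH prime_gt_0_nat[OF r(1)] in \<open>auto simp: prime_dvd_mult_iff dest: primes_dvd_imp_eq\<close>)
    qed
  qed
qed

text \<open>
  The factor \<open>m\<close> of \<open>n\<close> takes the prime factors of \<open>n\<close> from above: only the smallest prime factor
  of \<open>m\<close> can occur in the cofactor as well.
\<close>
definition top_factor :: "nat \<Rightarrow> nat \<Rightarrow> bool" where
  "top_factor m n \<longleftrightarrow> m dvd n \<and>
     (\<forall>q r. prime q \<longrightarrow> q dvd m \<longrightarrow> prime r \<longrightarrow> r dvd n div m \<longrightarrow> r \<le> q)"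

text \<open>
  The prime \<open>p\<close> is a threshold that separates the prime factors of the two cofactors.
\<close>
lemma top_factorI:
  fixes p :: nat
  assumes "n = m * t" "m > 0" "\<And>q. \<lbrakk>prime q; q dvd m\<rbrakk> \<Longrightarrow> p \<le> q" "\<And>r. \<lbrakk>prime r; r dvd t\<rbrakk> \<Longrightarrow> r \<le> p"
  shows "top_factor m n"
  using assms by (auto simp: top_factor_def intro: order_trans)

lemma dvd_sum_of_fibers:
  fixes w :: "'a \<Rightarrow> nat"
  assumes "finite S" "\<And>x. x \<in> S \<Longrightarrow> d dvd (\<Sum>y | y \<in> S \<and> f y = f x. w y)"
  shows "d dvd sum w S"
proof -
  have "(\<Sum>b\<in>f ` S. sum w {y \<in> S. f y = b}) = sum w S"
    using sum.group[of S "f ` S" f w] assms(1) by simp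
  moreover have "d dvd (\<Sum>b\<in>f ` S. sum w {y \<in> S. f y = b})"
  proof (rule dvd_sum)
    fix b assume "b \<in> f ` S"
    then obtain x where "x \<in> S" "b = f x" by (rule imageE)
    then show "d dvd sum w {y \<in> S. f y = b}" using assms(2)[of x] by simp
  qed
  ultimately show ?thesis by simp
qed

lemma dvd_card_of_fibers:
  assumes "finite S" "\<And>x. x \<in> S \<Longrightarrow> d dvd card {y \<in> S. f y = f x}"
  shows "d dvd card S"
  using dvd_sum_of_fibers[where w = "\<lambda>_. 1" and f = f] assms by simp

section \<open>Finite groups: powers, conjugation, centralizers\<close>

locale finite_group = group +
  assumes finite_carrier [simp]: "finite (carrier G)"
begin

lemma finite_subgroup: "subgroup H G \<Longrightarrow> finite H"
  using finite_carrier finite_subset subgroup.subset by blast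

lemma card_subgroup_pos: "subgroup H G \<Longrightarrow> 0 < card H"
  using finite_subgroup[of H] subgroup.one_closed[of H G] by (auto simp: card_gt_0_iff)

lemma ord_pos: "x \<in> carrier G \<Longrightarrow> 0 < ord x"
  using ord_ge_1[OF finite_carrier] by force

lemma generate_powers: "x \<in> carrier G \<Longrightarrow> generate G {x} = range (\<lambda>k::nat. x [^] k)"
  using generate_pow_on_finite_carrier[OF finite_carrier] by auto

lemma subgroup_generate: "x \<in> carrier G \<Longrightarrow> subgroup (generate G {x}) G"
  by (simp add: generate_is_subgroup)

lemma finite_generate: "x \<in> carrier G \<Longrightarrow> finite (generate G {x})"
  by (simp add: finite_subgroup subgroup_generate)

lemma generate_self: "x \<in> generate G {x}"
  by (simp add: generate.incl)

lemma generate_mono_elem: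
  "\<lbrakk>subgroup H G; x \<in> H\<rbrakk> \<Longrightarrow> generate G {x} \<subseteq> H"
  by (simp add: generate_subgroup_incl)

lemma subgroup_nat_pow: "\<lbrakk>subgroup H G; x \<in> H\<rbrakk> \<Longrightarrow> x [^] (k::nat) \<in> H"
  by (induction k) (auto simp: subgroup.one_closed subgroup.m_closed)

lemma card_dvd_card:
  assumes "subgroup K G" "subgroup H G" "K \<subseteq> H"
  shows "card K dvd card H"
proof -
  have "subgroup K (G\<lparr>carrier := H\<rparr>)"
    using assms by (simp add: subgroup_incl)
  then show ?thesis
    using group.lagrange[OF subgroup_imp_group[OF assms(2)], of K]
    by (simp add: order_def) (metis dvd_triv_right)
qed

lemma ord_dvd_card:
  assumes "subgroup H G" "x \<in> H"
  shows "ord x dvd card H"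
  using card_dvd_card[OF subgroup_generate assms(1) generate_mono_elem[OF assms]]
    generate_pow_card[of x] subgroup.mem_carrier[OF assms] by simp

lemma pow_cong:
  assumes "g \<in> carrier G" "[m = n] (mod ord g)"
  shows "g [^] m = g [^] n"
proof -
  have "int (ord g) dvd int n - int m"
    using cong_sym[OF assms(2)] by (simp add: cong_iff_dvd_diff flip: cong_int_iff)
  then show ?thesis using int_pow_eq[OF assms(1), of "int m" "int n"] by (simp add: int_pow_int)
qed

lemma pow_cong_1:
  assumes "g \<in> carrier G" "ord g dvd m" "[a = 1] (mod m)"
  shows "g [^] a = g"
  using pow_cong[OF assms(1) cong_dvd_modulus_nat[OF assms(3,2)]] assms(1) by simp

lemma ord_pow_div:
  assumes "x \<in> carrier G" "d dvd ord x"
  shows "ord (x [^] (ord x div d)) = d"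
proof -
  obtain k where k: "ord x = d * k" using assms(2) by blast
  then have "d > 0" "k > 0" using ord_pos[OF assms(1)] by auto
  then show ?thesis using ord_pow[OF assms(1), of k] k by simp
qed

text \<open>
  A cyclic group has only one subgroup of each order. In terms of exponents: with \<open>y = g [^] a\<close> and
  \<open>x = g [^] b\<close> the orders say that \<open>gcd (ord g) a\<close> divides \<open>b\<close>, so \<open>a * t\<close> is congruent to \<open>b\<close>
  modulo \<open>ord g\<close> for some \<open>t\<close>.
\<close>
lemma mem_generate_if_ord_dvd:
  assumes g: "g \<in> carrier G" and x: "x \<in> generate G {g}" and y: "y \<in> generate G {g}"
    and dvd: "ord x dvd ord y"
  shows "x \<in> generate G {y}"
proof -
  obtain a b :: nat where a: "y = g [^] a" and b: "x = g [^] b"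
    using x y generate_powers[OF g] by auto
  have yG: "y \<in> carrier G" and xG: "x \<in> carrier G" using a b g by auto
  define N where "N = ord g"
  have N0: "N > 0" using ord_pos[OF g] by (simp add: N_def)
  have "\<exists>t. [a * t = b] (mod N)"
  proof -
    have "x [^] ord y = \<one>" using dvd xG by (simp add: pow_eq_id)
    then have "N dvd b * ord y" using g b by (simp add: nat_pow_pow pow_eq_id N_def)
    moreover have "N = gcd N a * ord y"
    proof (cases "a = 0")
      case True
      then show ?thesis using a by simp
    next
      case False
      then show ?thesis using a g by (simp add: ord_pow_gen N_def)
    qed
    ultimately have "gcd N a * ord y dvd b * ord y" by simp
    then have "gcd N a dvd b" using ord_pos[OF yG] by simp
    then obtain c where c: "b = gcd a N * c" by (metis dvdE gcd.commute)
    obtain t where "[a * t = gcd a N] (mod N)" using cong_solve_nat[of a N] by blast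
    then have "[a * t * c = gcd a N * c] (mod N)" by (rule cong_scalar_right)
    then have "[a * (t * c) = b] (mod N)" by (simp add: c mult.assoc)
    then show ?thesis by blast
  qed
  then obtain t where t: "[a * t = b] (mod N)" by blast
  have "y [^] t = x"
    using pow_cong[OF g t[unfolded N_def]] a b g by (simp add: nat_pow_pow)
  then show ?thesis using generate_powers[OF yG] by auto
qed

text \<open>
  The orbit-stabilizer theorem without an action: by the assumption, two elements of \<open>P\<close> have equal
  images iff they lie in the same left coset of the fiber over \<open>f \<one>\<close>. Both conjugacy classes and sets of
  cosets are counted with it.
\<close>
lemma card_coset_fibers:
  assumes P: "subgroup P G"
    and f: "\<And>a b. \<lbrakk>a \<in> P; b \<in> P\<rbrakk> \<Longrightarrow> f a = f b \<longleftrightarrow> f (inv a \<otimes> b) = f \<one>"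
  shows "card (f ` P) * card {a \<in> P. f a = f \<one>} = card P"
proof -
  have fin: "finite P" using finite_subgroup[OF P] .
  have PG: "P \<subseteq> carrier G" using subgroup.subset[OF P] .
  have "card {b \<in> P. f b = f a} = card {a \<in> P. f a = f \<one>}" if a: "a \<in> P" for a
  proof (rule sym, rule bij_betw_same_card[of "\<lambda>s. a \<otimes> s"], rule bij_betw_byWitness[where f' = "\<lambda>b. inv a \<otimes> b"])
    have ia: "inv a \<in> P" using P a by (simp add: subgroup.m_inv_closed)
    show "\<forall>s\<in>{a \<in> P. f a = f \<one>}. inv a \<otimes> (a \<otimes> s) = s" 
      using a PG by (auto simp: subset_eq inv_solve_left')
    show "\<forall>b\<in>{b \<in> P. f b = f a}. a \<otimes> (inv a \<otimes> b) = b"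
      using a PG by (auto simp: subset_eq inv_solve_left' simp flip: m_assoc)
    show "(\<lambda>s. a \<otimes> s) ` {a \<in> P. f a = f \<one>} \<subseteq> {b \<in> P. f b = f a}"
    proof safe
      fix s assume s: "s \<in> P" "f s = f \<one>"
      show as: "a \<otimes> s \<in> P" using P a s by (simp add: subgroup.m_closed)
      have "inv a \<otimes> (a \<otimes> s) = s" using a s PG by (auto simp: subset_eq simp flip: m_assoc)
      then show "f (a \<otimes> s) = f a" using f[OF a as] s by simp
    qed
    show "(\<lambda>b. inv a \<otimes> b) ` {b \<in> P. f b = f a} \<subseteq> {a \<in> P. f a = f \<one>}"
    proof safe
      fix b assume b: "b \<in> P" "f b = f a"
      show "inv a \<otimes> b \<in> P" using P ia b by (simp add: subgroup.m_closed)
      show "f (inv a \<otimes> b) = f \<one>" using f[OF a b(1)] b by simp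
    qed
  qed
  then have "(\<Sum>c\<in>f ` P. card {b \<in> P. f b = c}) = (\<Sum>c\<in>f ` P. card {a \<in> P. f a = f \<one>})"
    by (intro sum.cong) auto
  moreover have "(\<Sum>c\<in>f ` P. card {b \<in> P. f b = c}) = card P"
    using sum.group[of P "f ` P" f "\<lambda>_. 1::nat"] fin by simp
  ultimately show ?thesis by simp
qed

definition conj_by :: "'a \<Rightarrow> 'a \<Rightarrow> 'a" where
  "conj_by a x = a \<otimes> x \<otimes> inv a"

lemma conj_by_closed [simp]: "\<lbrakk>a \<in> carrier G; x \<in> carrier G\<rbrakk> \<Longrightarrow> conj_by a x \<in> carrier G"
  by (simp add: conj_by_def)

lemma conj_in_subgroup: "\<lbrakk>subgroup H G; a \<in> H; x \<in> H\<rbrakk> \<Longrightarrow> conj_by a x \<in> H"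
  by (simp add: conj_by_def subgroup.m_closed subgroup.m_inv_closed)

lemma conj_mult: "\<lbrakk>a \<in> carrier G; x \<in> carrier G; y \<in> carrier G\<rbrakk> \<Longrightarrow> conj_by a (x \<otimes> y) = conj_by a x \<otimes> conj_by a y"
  by (simp add: conj_by_def m_assoc) (simp flip: m_assoc)

lemma conj_by_one [simp]: "x \<in> carrier G \<Longrightarrow> conj_by \<one> x = x" "a \<in> carrier G \<Longrightarrow> conj_by a \<one> = \<one>"
  by (simp_all add: conj_by_def)

lemma conj_conj: "\<lbrakk>a \<in> carrier G; b \<in> carrier G; x \<in> carrier G\<rbrakk> \<Longrightarrow> conj_by a (conj_by b x) = conj_by (a \<otimes> b) x"
  by (simp add: conj_by_def m_assoc inv_mult_group)

lemma conj_pow: "\<lbrakk>a \<in> carrier G; x \<in> carrier G\<rbrakk> \<Longrightarrow> conj_by a (x [^] (n::nat)) = conj_by a x [^] n"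
  by (induction n) (simp_all add: conj_mult)

lemma conj_eq_iff: "\<lbrakk>a \<in> carrier G; x \<in> carrier G; y \<in> carrier G\<rbrakk> \<Longrightarrow> conj_by a x = y \<longleftrightarrow> x = conj_by (inv a) y"
  by (metis conj_by_closed conj_conj conj_by_one(1) inv_closed l_inv r_inv)

lemma conj_fix_iff: "\<lbrakk>a \<in> carrier G; x \<in> carrier G\<rbrakk> \<Longrightarrow> conj_by a x = x \<longleftrightarrow> a \<otimes> x = x \<otimes> a"
  by (simp add: conj_by_def inv_solve_right')

lemma ord_conj: "\<lbrakk>a \<in> carrier G; x \<in> carrier G\<rbrakk> \<Longrightarrow> ord (conj_by a x) = ord x"
proof -
  assume a: "a \<in> carrier G" "x \<in> carrier G"
  have "conj_by a x [^] n = \<one> \<longleftrightarrow> x [^] n = \<one>" for n :: nat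
    using a by (metis conj_eq_iff conj_by_one(2) conj_pow inv_closed nat_pow_closed one_closed)
  then show ?thesis using a by (simp add: ord_unique pow_eq_id)
qed

lemma commute_pow:
  assumes "a \<in> carrier G" "x \<in> carrier G" "a \<otimes> x = x \<otimes> a"
  shows "a \<otimes> x [^] (k::nat) = x [^] k \<otimes> a"
  using assms by (simp add: conj_pow flip: conj_fix_iff)

lemma ord_mult_coprime:
  assumes C: "x \<in> carrier G" "y \<in> carrier G" "x \<otimes> y = y \<otimes> x" "coprime (ord x) (ord y)"
  shows "ord (x \<otimes> y) = ord x * ord y"
proof (rule dvd_antisym)
  show "ord (x \<otimes> y) dvd ord x * ord y" using C by (intro ord_mul_divides)
  have part: "ord u dvd ord (u \<otimes> v)"
    if "u \<in> carrier G" "v \<in> carrier G" "u \<otimes> v = v \<otimes> u" "coprime (ord u) (ord v)" for u v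
  proof -
    have "(u \<otimes> v) [^] (ord (u \<otimes> v) * ord v) = \<one>"
      using that by (simp add: pow_eq_id)
    moreover have "v [^] (ord (u \<otimes> v) * ord v) = \<one>" using that by (simp add: pow_eq_id)
    ultimately have "u [^] (ord (u \<otimes> v) * ord v) = \<one>"
      using that by (simp add: pow_mult_distrib)
    then have "ord u dvd ord (u \<otimes> v) * ord v" using that by (simp add: pow_eq_id)
    then show ?thesis using that(4) by (simp add: coprime_dvd_mult_left_iff)
  qed
  have "ord x dvd ord (x \<otimes> y)" using part C by blast
  moreover have "ord y dvd ord (x \<otimes> y)"
    using part[OF C(2,1)] C(3,4) by (simp add: coprime_commute)
  ultimately show "ord x * ord y dvd ord (x \<otimes> y)" using C(4) by (rule divides_mult)
qed

lemma left_factor_mem_generate: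
  assumes C: "x \<in> carrier G" "y \<in> carrier G" "x \<otimes> y = y \<otimes> x" "coprime (ord x) (ord y)"
  shows "x \<in> generate G {x \<otimes> y}"
proof -
  obtain e where e: "[e = 1] (mod ord x)" "[e = 0] (mod ord y)"
    using binary_chinese_remainder_nat[OF C(4), of 1 0] by blast
  have "(x \<otimes> y) [^] e = x [^] e \<otimes> y [^] e" by (rule pow_mult_distrib[OF C(3,1,2)])
  also have "x [^] e = x" using pow_cong_1[OF C(1) _ e(1)] by simp
  also have "y [^] e = \<one>" using e(2) C(2) by (simp add: pow_eq_id cong_0_iff)
  finally have "x = (x \<otimes> y) [^] e" using C by simp
  then show ?thesis unfolding generate_powers[OF m_closed[OF C(1,2)]] by (rule range_eqI)
qed

definition centralizer :: "'a set \<Rightarrow> 'a \<Rightarrow> 'a set" where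
  "centralizer H y = {x \<in> H. x \<otimes> y = y \<otimes> x}"

lemma subgroup_centralizer:
  assumes "subgroup H G" "y \<in> carrier G"
  shows "subgroup (centralizer H y) G"
proof
  have HG: "x \<in> carrier G" if "x \<in> H" for x using subgroup.mem_carrier[OF assms(1) that] .
  show "centralizer H y \<subseteq> carrier G" by (auto simp: centralizer_def HG)
  show "x \<otimes> z \<in> centralizer H y" if "x \<in> centralizer H y" "z \<in> centralizer H y" for x z
    using that assms by (auto simp: centralizer_def subgroup.m_closed) (metis m_assoc HG)
  show "\<one> \<in> centralizer H y" using assms by (simp add: centralizer_def subgroup.one_closed)
  show "inv x \<in> centralizer H y" if x: "x \<in> centralizer H y" for x
  proof -
    have "conj_by x y = y" "x \<in> H" using x assms by (auto simp: centralizer_def conj_fix_iff HG)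
    then have "conj_by (inv x) y = y" using conj_eq_iff[of x y y] assms by (simp add: HG)
    then show ?thesis using \<open>x \<in> H\<close> assms
      by (simp add: centralizer_def subgroup.m_inv_closed HG conj_fix_iff)
  qed
qed

lemma card_conj_class:
  assumes H: "subgroup H G" and y: "y \<in> H"
  shows "card ((\<lambda>h. conj_by h y) ` H) * card (centralizer H y) = card H"
proof -
  have yG: "y \<in> carrier G" using subgroup.mem_carrier[OF H y] .
  have "centralizer H y = {a \<in> H. conj_by a y = conj_by \<one> y}"
    using H yG by (auto simp: centralizer_def conj_fix_iff subgroup.mem_carrier)
  moreover have "conj_by a y = conj_by b y \<longleftrightarrow> conj_by (inv a \<otimes> b) y = conj_by \<one> y" if "a \<in> H" "b \<in> H" for a b
  proof -
    have ab: "a \<in> carrier G" "b \<in> carrier G" using that H by (auto simp: subgroup.mem_carrier)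
    have "conj_by (inv a \<otimes> b) y = conj_by (inv a) (conj_by b y)" using ab yG by (simp add: conj_conj)
    then show ?thesis using ab yG conj_eq_iff[of a y "conj_by b y"] by auto
  qed
  ultimately show ?thesis using card_coset_fibers[OF H, of "\<lambda>h. conj_by h y"] by simp
qed

end

section \<open>Conjugating \<open>p\<close>-subgroups into a Sylow subgroup\<close>

context finite_group
begin

lemma coset_eq_iff:
  assumes Q: "subgroup Q G" and ab: "a \<in> carrier G" "b \<in> carrier G"
  shows "(\<otimes>) a ` Q = (\<otimes>) b ` Q \<longleftrightarrow> inv a \<otimes> b \<in> Q"
proof
  have QG: "x \<in> carrier G" if "x \<in> Q" for x using subgroup.mem_carrier[OF Q that] .
  assume "(\<otimes>) a ` Q = (\<otimes>) b ` Q"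
  moreover have "b \<otimes> \<one> \<in> (\<otimes>) b ` Q" using subgroup.one_closed[OF Q] by (rule imageI)
  ultimately have "b \<in> (\<otimes>) a ` Q" using ab by simp
  then obtain q where q: "b = a \<otimes> q" "q \<in> Q" by (rule imageE)
  have "inv a \<otimes> (a \<otimes> q) = q" using ab(1) QG[OF q(2)] by (simp flip: m_assoc)
  then show "inv a \<otimes> b \<in> Q" using q by simp
next
  have QG: "x \<in> carrier G" if "x \<in> Q" for x using subgroup.mem_carrier[OF Q that] .
  have sub: "(\<otimes>) b ` Q \<subseteq> (\<otimes>) a ` Q" if "inv a \<otimes> b \<in> Q" "a \<in> carrier G" "b \<in> carrier G" for a b
  proof safe
    fix q assume q: "q \<in> Q"
    then have "b \<otimes> q = a \<otimes> (inv a \<otimes> b \<otimes> q)" using that(2,3) QG[OF q] by (simp flip: m_assoc)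
    then show "b \<otimes> q \<in> (\<otimes>) a ` Q" using q that subgroup.m_closed[OF Q] by blast
  qed
  assume "inv a \<otimes> b \<in> Q"
  moreover from this have "inv b \<otimes> a \<in> Q"
    using subgroup.m_inv_closed[OF Q, of "inv a \<otimes> b"] ab by (simp add: inv_mult_group)
  ultimately show "(\<otimes>) a ` Q = (\<otimes>) b ` Q" using sub[of a b] sub[of b a] ab by (intro equalityI)
qed

lemma card_cosets:
  assumes H: "subgroup H G" and Q: "subgroup Q G" "Q \<subseteq> H"
  shows "card ((\<lambda>a. (\<otimes>) a ` Q) ` H) * card Q = card H"
proof -
  have HG: "x \<in> carrier G" if "x \<in> H" for x using subgroup.mem_carrier[OF H that] .
  have one: "(\<otimes>) a ` Q = (\<otimes>) \<one> ` Q \<longleftrightarrow> a \<in> Q" if "a \<in> H" for a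
    using coset_eq_iff[OF Q(1), of \<one> a] HG[OF that] by (simp add: eq_commute)
  then have "{a \<in> H. (\<otimes>) a ` Q = (\<otimes>) \<one> ` Q} = Q"
    using Q(2) by blast
  moreover have "(\<otimes>) a ` Q = (\<otimes>) b ` Q \<longleftrightarrow> (\<otimes>) (inv a \<otimes> b) ` Q = (\<otimes>) \<one> ` Q"
    if "a \<in> H" "b \<in> H" for a b
    using that one coset_eq_iff[OF Q(1)] HG H by (simp add: subgroup.m_closed subgroup.m_inv_closed)
  ultimately show ?thesis
    using card_coset_fibers[OF H, of "\<lambda>a. (\<otimes>) a ` Q"] by simp
qed

text \<open>
  This gives the conjugacy part of Sylow's theorem, relative to a subgroup \<open>H\<close>. The \<open>p\<close>-group \<open>P\<close>
  permutes the left cosets of \<open>Q\<close> in \<open>H\<close>; orbits that are not a single point have a size divisible by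
  \<open>p\<close>, but the number of cosets is not. A fixed coset \<open>x Q\<close> means that \<open>inv x\<close> conjugates \<open>P\<close>
  into \<open>Q\<close>.
\<close>
lemma fixed_coset:
  assumes H: "subgroup H G" and P: "subgroup P G" "P \<subseteq> H" and Q: "subgroup Q G" "Q \<subseteq> H"
    and p: "prime p" and cP: "card P = p ^ k"
    and cQ: "\<not> p dvd card H div card Q"
  obtains h where "h \<in> H" "\<And>x. x \<in> P \<Longrightarrow> conj_by h x \<in> Q"
proof -
  have HG: "x \<in> carrier G" if "x \<in> H" for x using subgroup.mem_carrier[OF H that] .
  have PH: "x \<in> H" if "x \<in> P" for x using P(2) that by blast
  define X where "X = (\<lambda>a. (\<otimes>) a ` Q) ` H"
  define orb where "orb Y = (\<lambda>a. (\<otimes>) a ` Y) ` P" for Y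
  have finX: "finite X" using finite_subgroup[OF H] by (simp add: X_def)
  have "card Q \<noteq> 0"
    using finite_subgroup[OF Q(1)] subgroup.one_closed[OF Q(1)] by auto
  then have cX: "card H div card Q = card X"
    unfolding card_cosets[OF H Q, symmetric] X_def by simp
  have shift: "(\<otimes>) a ` (\<otimes>) x ` Q = (\<otimes>) (a \<otimes> x) ` Q" if "a \<in> H" "x \<in> H" for a x
    unfolding image_image using that HG Q(2) by (intro image_cong) (auto simp: m_assoc)
  \<comment> \<open>Without a fixed point, all orbits and hence the number of cosets would be divisible by \<open>p\<close>.\<close>
  have "\<exists>x\<in>H. \<forall>a\<in>P. (\<otimes>) (a \<otimes> x) ` Q = (\<otimes>) x ` Q"
  proof (rule ccontr)
    assume nofix: "\<not> ?thesis"
    have "p dvd card X"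
    proof (rule dvd_card_of_fibers[OF finX, of _ orb])
      fix Y assume "Y \<in> X"
      then obtain x where x: "x \<in> H" and Y: "Y = (\<otimes>) x ` Q" by (auto simp: X_def)
      define f where "f a = (\<otimes>) (a \<otimes> x) ` Q" for a
      have orbY: "orb Y = f ` P"
        unfolding orb_def f_def Y by (rule image_cong[OF refl]) (simp add: shift x PH)
      have stab: "f a = f b \<longleftrightarrow> f (inv a \<otimes> b) = f \<one>" if "a \<in> P" "b \<in> P" for a b
      proof -
        have "inv (a \<otimes> x) \<otimes> (b \<otimes> x) = inv x \<otimes> (inv a \<otimes> b \<otimes> x)"
          using that PH HG x by (simp add: inv_mult_group m_assoc)
        moreover have "f a = f b \<longleftrightarrow> inv (a \<otimes> x) \<otimes> (b \<otimes> x) \<in> Q"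
          unfolding f_def using that PH HG x by (intro coset_eq_iff[OF Q(1)]) auto
        moreover have "f \<one> = f (inv a \<otimes> b) \<longleftrightarrow> inv (\<one> \<otimes> x) \<otimes> (inv a \<otimes> b \<otimes> x) \<in> Q"
          unfolding f_def using that PH HG x by (intro coset_eq_iff[OF Q(1)]) auto
        ultimately show ?thesis using HG[OF x] by (auto simp: eq_commute)
      qed
      have "{Z \<in> X. orb Z = orb Y} = f ` P"
      proof (intro equalityI subsetI)
        fix Z assume "Z \<in> {Z \<in> X. orb Z = orb Y}"
        then have Z: "Z \<in> X" "orb Z = orb Y" by auto
        then obtain z where z: "z \<in> H" "Z = (\<otimes>) z ` Q" by (auto simp: X_def)
        have "(\<otimes>) \<one> ` Z \<in> orb Z" unfolding orb_def using subgroup.one_closed[OF P(1)] by (rule imageI)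
        moreover have "(\<otimes>) \<one> ` Z = Z" unfolding z(2) using shift[of \<one> z] z(1) HG[OF z(1)] subgroup.one_closed[OF H] by simp
        ultimately show "Z \<in> f ` P" using Z orbY by simp
      next
        fix Z assume "Z \<in> f ` P"
        then obtain c where c: "c \<in> P" "Z = f c" by blast
        have cH: "c \<in> H" "c \<otimes> x \<in> H" using c(1) PH x subgroup.m_closed[OF H] by auto
        have "Z \<in> X" unfolding X_def c(2) f_def using cH by blast
        moreover have "orb Z = orb Y"
        proof -
          have "orb Z = (\<lambda>a. f (a \<otimes> c)) ` P"
            unfolding orb_def c(2) f_def using cH PH HG x
            by (intro image_cong[OF refl]) (simp add: shift m_assoc)
          also have "\<dots> = f ` ((\<lambda>a. a \<otimes> c) ` P)" by (simp add: image_image)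
          also have "(\<lambda>a. a \<otimes> c) ` P = P"
          proof (intro equalityI subsetI)
            fix u assume "u \<in> (\<lambda>a. a \<otimes> c) ` P"
            then show "u \<in> P" using c(1) subgroup.m_closed[OF P(1)] by blast
          next
            fix u assume u: "u \<in> P"
            then have "u = (u \<otimes> inv c) \<otimes> c" using c(1) PH HG by (simp add: m_assoc)
            moreover have "u \<otimes> inv c \<in> P" using u c(1) P(1) by (simp add: subgroup.m_closed subgroup.m_inv_closed)
            ultimately show "u \<in> (\<lambda>a. a \<otimes> c) ` P" by blast
          qed
          finally show ?thesis using orbY by simp
        qed
        ultimately show "Z \<in> {Z \<in> X. orb Z = orb Y}" by simp
      qed
      moreover have "p dvd card (f ` P)"
      proof -
        have eq: "card (f ` P) * card {a \<in> P. f a = f \<one>} = p ^ k"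
          using card_coset_fibers[OF P(1) stab] cP by simp
        \<comment> \<open>An orbit has \<open>p\<close>-power size, so it suffices to exclude size 1.\<close>
        have "card (f ` P) \<noteq> 1"
        proof
          assume "card (f ` P) = 1"
          then obtain c where c: "f ` P = {c}" by (rule card_1_singletonE)
          have "f a = c" if "a \<in> P" for a
            using imageI[OF that, of f] unfolding c by simp
          then have "f a = f \<one>" if "a \<in> P" for a
            using that subgroup.one_closed[OF P(1)] by simp
          then have "(\<otimes>) (a \<otimes> x) ` Q = (\<otimes>) x ` Q" if "a \<in> P" for a
            using that HG[OF x] by (simp add: f_def)
          then have "\<exists>x\<in>H. \<forall>a\<in>P. (\<otimes>) (a \<otimes> x) ` Q = (\<otimes>) x ` Q"
            using x by (intro bexI[of _ x] ballI)
          then show False using nofix by contradiction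
        qed
        moreover obtain i where "card (f ` P) = p ^ i"
          using prime_power_dvdE[OF p dvdI[OF eq[symmetric]]] by blast
        ultimately show ?thesis by (cases i) auto
      qed
      ultimately show "p dvd card {Z \<in> X. orb Z = orb Y}" by simp
    qed
    then show False using cQ cX by simp
  qed
  then obtain x where x: "x \<in> H" and fx: "\<forall>a\<in>P. (\<otimes>) (a \<otimes> x) ` Q = (\<otimes>) x ` Q"
    by (rule bexE)
  show ?thesis
  proof (rule that[of "inv x"])
    show "inv x \<in> H" using x H by (simp add: subgroup.m_inv_closed)
    fix a assume a: "a \<in> P"
    have "inv x \<otimes> (a \<otimes> x) \<in> Q"
      using bspec[OF fx a] coset_eq_iff[OF Q(1), of x "a \<otimes> x"] x a PH HG by simp
    then show "conj_by (inv x) a \<in> Q" using x a PH HG by (simp add: conj_by_def m_assoc)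
  qed
qed

end

section \<open>Roots of unity in a finite group\<close>

context finite_group
begin

definition roots :: "'a set \<Rightarrow> nat \<Rightarrow> 'a set" where
  "roots H m = {x \<in> H. x [^] m = \<one>}"

lemma finite_roots: "subgroup H G \<Longrightarrow> finite (roots H m)"
  using finite_subgroup by (simp add: roots_def)

lemma roots_card: "subgroup H G \<Longrightarrow> roots H (card H) = H"
  using ord_dvd_card subgroup.mem_carrier[of H G] by (auto simp: roots_def pow_eq_id)

lemma roots_iff: "subgroup H G \<Longrightarrow> x \<in> roots H m \<longleftrightarrow> x \<in> H \<and> ord x dvd m"
  using subgroup.mem_carrier[of H G] by (auto simp: roots_def pow_eq_id)

lemma roots_mono: "subgroup H G \<Longrightarrow> m dvd m' \<Longrightarrow> roots H m \<subseteq> roots H m'"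
  by (auto simp: roots_iff)

lemma roots_gcd: "subgroup H G \<Longrightarrow> roots H (gcd m (card H)) = roots H m"
  using ord_dvd_card by (auto simp: roots_iff)

lemma generate_subset_roots:
  assumes "subgroup H G" "x \<in> H" "ord x dvd m"
  shows "generate G {x} \<subseteq> roots H m"
proof
  fix y assume y: "y \<in> generate G {x}"
  have xG: "x \<in> carrier G" using subgroup.mem_carrier assms(1,2) by metis
  have "ord y dvd ord x" using ord_dvd_card[OF subgroup_generate[OF xG] y] generate_pow_card[OF xG] by simp
  moreover have "y \<in> H" using generate_mono_elem[OF assms(1,2)] y by blast
  ultimately show "y \<in> roots H m" using assms(1,3) by (auto simp: roots_iff)
qed

lemma roots_eq_generate:
  assumes "subgroup H G" "x \<in> H" "ord x = m" "card (roots H m) = m"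
  shows "roots H m = generate G {x}"
  using card_subset_eq[OF finite_roots[OF assms(1)] generate_subset_roots[OF assms(1,2)], of m] 
    assms generate_pow_card[of x] subgroup.mem_carrier[OF assms(1,2)] by simp

text \<open>
  Every root of order dividing \<open>u * s\<close> is in a unique way a product of commuting elements of orders
  dividing \<open>u\<close> and \<open>s\<close>; the two parts are powers of the root, with exponents from the Chinese
  remainder theorem.
\<close>
lemma card_roots_coprime:
  assumes H: "subgroup H G" and co: "coprime u s" and "u > 0" "s > 0"
  shows "card (roots H (u * s)) = (\<Sum>y\<in>roots H u. card (roots (centralizer H y) s))"
proof -
  have HG: "x \<in> carrier G" if "x \<in> H" for x using subgroup.mem_carrier[OF H that] .
  obtain e where e: "[e = 1] (mod u)" "[e = 0] (mod s)"
    using binary_chinese_remainder_nat[OF co, of 1 0] by blast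
  obtain f where f: "[f = 0] (mod u)" "[f = 1] (mod s)"
    using binary_chinese_remainder_nat[OF co, of 0 1] by blast
  have ef: "[e + f = 1] (mod (u * s))"
    using cong_add[OF e(1) f(1)] cong_add[OF e(2) f(2)] co
    by (simp add: coprime_cong_mult_nat)
  have su: "s dvd e" "u dvd f" using e(2) f(1) by (simp_all add: cong_0_iff)
  have "bij_betw (\<lambda>(y, z). y \<otimes> z) (SIGMA y:roots H u. roots (centralizer H y) s) (roots H (u * s))"
  proof (rule bij_betw_byWitness[where f' = "\<lambda>x. (x [^] e, x [^] f)"])
    show "\<forall>x\<in>SIGMA y:roots H u. roots (centralizer H y) s.
        (\<lambda>x. (x [^] e, x [^] f)) ((\<lambda>(y, z). y \<otimes> z) x) = x"
    proof (clarify)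
      fix y z assume y: "y \<in> roots H u" and z: "z \<in> roots (centralizer H y) s"
      have C: "y \<in> carrier G" "z \<in> carrier G" "z \<otimes> y = y \<otimes> z" "ord y dvd u" "ord z dvd s"
        using y z HG by (auto simp: roots_def centralizer_def pow_eq_id)
      have "y [^] e = y" "z [^] f = z"
        using pow_cong_1[OF C(1,4) e(1)] pow_cong_1[OF C(2,5) f(2)] by simp_all
      moreover have "z [^] e = \<one>" "y [^] f = \<one>"
        using C su by (auto simp: pow_eq_id intro: dvd_trans)
      ultimately show "(y \<otimes> z) [^] e = y \<and> (y \<otimes> z) [^] f = z"
        using C by (simp add: pow_mult_distrib)
    qed
    show "\<forall>x\<in>roots H (u * s). (\<lambda>(y, z). y \<otimes> z) (x [^] e, x [^] f) = x"
    proof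
      fix x assume x: "x \<in> roots H (u * s)"
      then have "x \<in> carrier G" "ord x dvd u * s" using HG by (auto simp: roots_def pow_eq_id)
      then have "x [^] (e + f) = x"
        using ef by (rule pow_cong_1)
      then show "(\<lambda>(y, z). y \<otimes> z) (x [^] e, x [^] f) = x"
        using \<open>x \<in> carrier G\<close> by (simp add: nat_pow_mult)
    qed
    show "(\<lambda>(y, z). y \<otimes> z) ` (SIGMA y:roots H u. roots (centralizer H y) s) \<subseteq> roots H (u * s)"
    proof (clarify)
      fix y z assume y: "y \<in> roots H u" and z: "z \<in> roots (centralizer H y) s"
      have C: "y \<in> carrier G" "z \<in> carrier G" "y \<otimes> z = z \<otimes> y" "ord y dvd u" "ord z dvd s" "y \<in> H" "z \<in> H"
        using y z HG by (auto simp: roots_def centralizer_def pow_eq_id)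
      have "ord (y \<otimes> z) dvd u * s"
        using ord_mul_divides[OF C(3,1,2)] mult_dvd_mono[OF C(4,5)] by (rule dvd_trans)
      then show "y \<otimes> z \<in> roots H (u * s)"
        using C(6,7) H by (simp add: roots_iff subgroup.m_closed)
    qed
    show "(\<lambda>x. (x [^] e, x [^] f)) ` roots H (u * s) \<subseteq> (SIGMA y:roots H u. roots (centralizer H y) s)"
    proof (clarify)
      fix x assume x: "x \<in> roots H (u * s)"
      then have C: "x \<in> H" "x \<in> carrier G" "ord x dvd u * s" using HG by (auto simp: roots_def pow_eq_id)
      have "ord x dvd e * u" "ord x dvd f * s"
        using C(3) su by (metis dvd_trans mult.commute mult_dvd_mono dvd_refl)+
      then show "x [^] e \<in> roots H u \<and> x [^] f \<in> roots (centralizer H (x [^] e)) s"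
        using C H by (auto simp: roots_def centralizer_def subgroup_nat_pow nat_pow_pow pow_eq_id nat_pow_mult add.commute)
    qed
  qed
  then have "card (roots H (u * s)) = card (SIGMA y:roots H u. roots (centralizer H y) s)"
    by (simp add: bij_betw_same_card)
  also have "\<dots> = (\<Sum>y\<in>roots H u. card (roots (centralizer H y) s))"
    using finite_roots[OF H] finite_roots[OF subgroup_centralizer[OF H]] HG
    by (intro card_SigmaI) (auto simp: roots_def)
  finally show ?thesis .
qed

lemma card_generators:
  assumes x: "x \<in> carrier G"
  shows "card {y \<in> carrier G. generate G {y} = generate G {x}} = totient (ord x)"
proof -
  define N where "N = ord x"
  have N0: "N > 0" using ord_pos[OF x] by (simp add: N_def)
  have "{y \<in> carrier G. generate G {y} = generate G {x}} = (\<lambda>i. x [^] i) ` totatives N"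
  proof (intro equalityI subsetI)
    fix y assume "y \<in> {y \<in> carrier G. generate G {y} = generate G {x}}"
    then have y: "y \<in> carrier G" "generate G {y} = generate G {x}" by auto
    then have "y \<in> generate G {x}" using generate_self[of y] by simp
    then obtain k :: nat where k: "y = x [^] k" using generate_powers[OF x] by auto
    have "ord y = ord x" using y x by (simp add: generate_pow_card)
    then have co: "coprime k N" using pow_ord_eq_ord_iff[OF finite_carrier x] k by (simp add: N_def)
    \<comment> \<open>\<open>totatives N\<close> is a subset of \<open>{1..N}\<close>, so the representative of \<open>0\<close> is \<open>N\<close>; it matters for \<open>N = 1\<close>.\<close>
    define i where "i = (if k mod N = 0 then N else k mod N)"
    have ik: "[i = k] (mod N)" by (simp add: i_def cong_def)
    have "coprime i N" using cong_imp_coprime[OF cong_sym[OF ik] co] .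
    then have "i \<in> totatives N" using N0 mod_less_divisor[OF N0, of k]
      by (auto simp: in_totatives_iff i_def less_imp_le)
    moreover have "y = x [^] i" using pow_cong[OF x] ik k by (simp add: N_def)
    ultimately show "y \<in> (\<lambda>i. x [^] i) ` totatives N" by simp
  next
    fix y assume "y \<in> (\<lambda>i. x [^] i) ` totatives N"
    then obtain i where i: "i \<in> totatives N" "y = x [^] i" by blast
    have y: "y \<in> carrier G" using i x by simp
    have "ord y = ord x"
      using pow_ord_eq_ord_iff[OF finite_carrier x] i by (simp add: in_totatives_iff N_def)
    moreover have "y \<in> generate G {x}" using i(2) generate_powers[OF x] by simp
    ultimately have "generate G {y} = generate G {x}"
      using generate_mono_elem[OF subgroup_generate[OF x]] finite_generate[OF x]
        generate_pow_card[OF x] generate_pow_card[OF y] by (intro card_subset_eq) auto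
    then show "y \<in> {y \<in> carrier G. generate G {y} = generate G {x}}" using y by simp
  qed
  moreover have "inj_on (\<lambda>i. x [^] i) (totatives N)"
    using ord_inj'[OF x] by (rule inj_on_subset) (auto simp: in_totatives_iff N_def)
  ultimately show ?thesis by (simp add: card_image totient_def N_def)
qed

text \<open>
  The elements in question have order divisible by \<open>p ^ Suc j\<close>. Grouped by the cyclic subgroup that
  they generate, they form classes of size \<open>totient (ord x)\<close>, a multiple of
  \<open>totient (p ^ Suc j)\<close>.
\<close>
lemma totient_dvd_card_roots_diff:
  assumes H: "subgroup H G" and p: "prime p" and s: "\<not> p dvd s"
  shows "p ^ j * (p - 1) dvd card (roots H (p ^ Suc j * s) - roots H (p ^ j * s))"
proof (rule dvd_card_of_fibers[where f = "\<lambda>x. generate G {x}"])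
  let ?S = "roots H (p ^ Suc j * s) - roots H (p ^ j * s)"
  have HG: "x \<in> carrier G" if "x \<in> H" for x using subgroup.mem_carrier[OF H that] .
  show "finite ?S" using finite_roots[OF H] by simp
  fix x assume x: "x \<in> ?S"
  then have xH: "x \<in> H" and o: "ord x dvd p ^ Suc j * s" "\<not> ord x dvd p ^ j * s"
    using H by (auto simp: roots_iff)
  have "{y \<in> ?S. generate G {y} = generate G {x}} = {y \<in> carrier G. generate G {y} = generate G {x}}"
  proof (intro equalityI subsetI)
    fix y assume "y \<in> {y \<in> carrier G. generate G {y} = generate G {x}}"
    then have y: "y \<in> carrier G" "generate G {y} = generate G {x}" by auto
    have "y \<in> H" using generate_self[of y] y(2) generate_mono_elem[OF H xH] by auto
    moreover have "ord y = ord x" using y HG[OF xH] by (simp add: generate_pow_card)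
    ultimately show "y \<in> {y \<in> ?S. generate G {y} = generate G {x}}"
      using o y(2) H by (simp add: roots_iff)
  qed (use HG in \<open>auto simp: roots_def\<close>)
  then have "card {y \<in> ?S. generate G {y} = generate G {x}} = totient (ord x)"
    using card_generators[OF HG[OF xH]] by simp
  moreover have "p ^ Suc j dvd ord x"
  proof -
    obtain a b where ab: "ord x = a * b" "a dvd p ^ Suc j" "b dvd s"
      using o(1) by (rule dvd_productE)
    obtain i where i: "i \<le> Suc j" "a = p ^ i" using prime_power_dvdE[OF p ab(2)] .
    have "\<not> i \<le> j"
    proof
      assume "i \<le> j"
      then have "ord x dvd p ^ j * s" unfolding ab(1) i(2) by (intro mult_dvd_mono le_imp_power_dvd ab)
      then show False using o(2) by contradiction
    qed
    then have "i = Suc j" using i by simp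
    then show ?thesis using ab i by simp
  qed
  then have "totient (p ^ Suc j) dvd totient (ord x)" by (rule totient_dvd)
  then have "p ^ j * (p - 1) dvd totient (ord x)" unfolding totient_prime_power_Suc[OF p] .
  ultimately show "p ^ j * (p - 1) dvd card {y \<in> ?S. generate G {y} = generate G {x}}"
    by simp
qed

text \<open>
  The summand is constant on conjugacy classes, and the class of \<open>y\<close> has index-many elements, so the
  class contributes a multiple of \<open>card H div c * gcd s c\<close>, where \<open>c\<close> is the order of the
  centralizer. As \<open>s\<close> divides \<open>card H\<close>, it divides this number.
\<close>
lemma dvd_sum_card_roots_centralizer:
  assumes H: "subgroup H G" and s: "s dvd card H"
    and Y: "Y \<subseteq> H" "\<And>h y. \<lbrakk>h \<in> H; y \<in> Y\<rbrakk> \<Longrightarrow> conj_by h y \<in> Y"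
    and frob: "\<And>y. y \<in> Y \<Longrightarrow> gcd s (card (centralizer H y)) dvd card (roots (centralizer H y) s)"
  shows "s dvd (\<Sum>y\<in>Y. card (roots (centralizer H y) s))"
proof (rule dvd_sum_of_fibers[where f = "\<lambda>y. (\<lambda>h. conj_by h y) ` H"])
  have HG: "x \<in> carrier G" if "x \<in> H" for x using subgroup.mem_carrier[OF H that] .
  have YH: "y \<in> H" if "y \<in> Y" for y using Y(1) that by blast
  show "finite Y" using finite_subgroup[OF H] Y(1) by (rule rev_finite_subset)
  fix y assume y: "y \<in> Y"
  let ?cl = "\<lambda>y. (\<lambda>h. conj_by h y) ` H"
  have self: "z \<in> ?cl z" if "z \<in> Y" for z
    using subgroup.one_closed[OF H] HG YH[OF that] by (metis conj_by_one(1) imageI)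
  have conj_cl: "?cl (conj_by h z) = ?cl z" if hz: "h \<in> H" "z \<in> H" for h z
  proof (intro equalityI subsetI)
    fix w assume "w \<in> ?cl (conj_by h z)"
    then obtain k where k: "k \<in> H" "w = conj_by k (conj_by h z)" by (rule imageE)
    then have "w = conj_by (k \<otimes> h) z" "k \<otimes> h \<in> H" using hz HG H by (simp_all add: conj_conj subgroup.m_closed)
    then show "w \<in> ?cl z" by blast
  next
    fix w assume "w \<in> ?cl z"
    then obtain k where k: "k \<in> H" "w = conj_by k z" by (rule imageE)
    then have "w = conj_by (k \<otimes> inv h) (conj_by h z)" "k \<otimes> inv h \<in> H"
      using hz HG H by (simp_all add: conj_conj subgroup.m_closed subgroup.m_inv_closed m_assoc)
    then show "w \<in> ?cl (conj_by h z)" by blast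
  qed
  have fiber: "{z \<in> Y. ?cl z = ?cl y} = ?cl y"
  proof (intro equalityI subsetI)
    fix z assume "z \<in> {z \<in> Y. ?cl z = ?cl y}"
    then show "z \<in> ?cl y" using self[of z] by simp
  next
    fix z assume "z \<in> ?cl y"
    then obtain h where h: "h \<in> H" "z = conj_by h y" by (rule imageE)
    then show "z \<in> {z \<in> Y. ?cl z = ?cl y}" using Y(2)[OF h(1) y] conj_cl[OF h(1) YH[OF y]] by simp
  qed
  have const: "card (roots (centralizer H z) s) = card (roots (centralizer H y) s)" if z: "z \<in> ?cl y" for z
  proof -
    obtain h where h: "h \<in> H" "z = conj_by h y" using z by (rule imageE)
    note C = HG[OF h(1)] HG[OF YH[OF y]]
    have eq: "conj_by h w \<otimes> z = z \<otimes> conj_by h w \<longleftrightarrow> w \<otimes> y = y \<otimes> w" if w: "w \<in> H" for w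
    proof -
      have "conj_by h w \<otimes> z = conj_by h (w \<otimes> y)" "z \<otimes> conj_by h w = conj_by h (y \<otimes> w)"
        using C HG[OF w] h by (simp_all add: conj_mult)
      then show ?thesis using C HG[OF w] conj_eq_iff[of h "w \<otimes> y" "conj_by h (y \<otimes> w)"]
        by (simp add: conj_conj)
    qed
    have "bij_betw (conj_by h) (roots (centralizer H y) s) (roots (centralizer H z) s)"
    proof (rule bij_betw_byWitness[where f' = "conj_by (inv h)"])
      show "\<forall>w\<in>roots (centralizer H y) s. conj_by (inv h) (conj_by h w) = w"
        using C HG by (auto simp: roots_def centralizer_def conj_conj)
      show "\<forall>w\<in>roots (centralizer H z) s. conj_by h (conj_by (inv h) w) = w"
        using C HG by (auto simp: roots_def centralizer_def conj_conj)
      show "conj_by h ` roots (centralizer H y) s \<subseteq> roots (centralizer H z) s"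
      proof
        fix v assume "v \<in> conj_by h ` roots (centralizer H y) s"
        then obtain w where w: "w \<in> H" "w \<otimes> y = y \<otimes> w" "w [^] s = \<one>" "v = conj_by h w"
          by (auto simp: roots_def centralizer_def)
        have "conj_by h w [^] s = conj_by h (w [^] s)" using C HG[OF w(1)] by (simp add: conj_pow)
        then show "v \<in> roots (centralizer H z) s"
          using w eq[OF w(1)] C conj_in_subgroup[OF H h(1) w(1)] by (simp add: roots_def centralizer_def)
      qed
      show "conj_by (inv h) ` roots (centralizer H z) s \<subseteq> roots (centralizer H y) s"
      proof
        fix v assume "v \<in> conj_by (inv h) ` roots (centralizer H z) s"
        then obtain w where w: "w \<in> H" "w \<otimes> z = z \<otimes> w" "w [^] s = \<one>" "v = conj_by (inv h) w"
          by (auto simp: roots_def centralizer_def)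
        have vH: "v \<in> H" using w(1,4) h(1) H by (simp add: conj_in_subgroup subgroup.m_inv_closed)
        have "w = conj_by h v" using w C HG[OF w(1)] by (simp add: conj_conj)
        moreover have "v [^] s = conj_by (inv h) (w [^] s)" using C HG[OF w(1)] w(4) by (simp add: conj_pow)
        ultimately show "v \<in> roots (centralizer H y) s"
          using w eq[OF vH] C vH by (simp add: roots_def centralizer_def)
      qed
    qed
    then show ?thesis by (simp add: bij_betw_same_card)
  qed
  have "(\<Sum>z | z \<in> Y \<and> ?cl z = ?cl y. card (roots (centralizer H z) s))
      = card (?cl y) * card (roots (centralizer H y) s)"
    unfolding fiber using const by simp
  moreover have "s dvd card (?cl y) * card (roots (centralizer H y) s)"
  proof (rule dvd_trans)
    show "s dvd card (?cl y) * gcd s (card (centralizer H y))"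
      using s by (simp add: gcd_mult_distrib_nat card_conj_class[OF H YH[OF y]])
    show "card (?cl y) * gcd s (card (centralizer H y)) dvd card (?cl y) * card (roots (centralizer H y) s)"
      using frob[OF y] by (intro mult_dvd_mono dvd_refl)
  qed
  ultimately show "s dvd (\<Sum>z | z \<in> Y \<and> ?cl z = ?cl y. card (roots (centralizer H z) s))"
    by (rule ssubst)
qed

end

section \<open>Finite groups with cyclic Sylow subgroups\<close>

text \<open>
  That one Sylow \<open>p\<close>-subgroup is cyclic for each \<open>p\<close>, expressed by the order of a generator. In
  this form the condition passes to quotients directly.
\<close>
locale finite_Z_group = finite_group +
  assumes cyclic_sylow: "prime p \<Longrightarrow> \<exists>g\<in>carrier G. ord g = p ^ multiplicity p (order G)"
begin

text \<open>
  Some conjugate of \<open>P\<close> lies in a cyclic group, in which the orders of elements decide about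
  containment. Orders in \<open>P\<close> are powers of \<open>p\<close>, so they divide the largest one, and an element of largest
  order generates.
\<close>
lemma p_subgroup_cyclic:
  assumes p: "prime p" and P: "subgroup P G" "card P = p ^ k"
  obtains x where "x \<in> P" "ord x = card P"
proof -
  obtain g where g: "g \<in> carrier G" "ord g = p ^ multiplicity p (order G)"
    using cyclic_sylow[OF p] by blast
  have cQ: "\<not> p dvd card (carrier G) div card (generate G {g})"
    using prime_not_dvd_div_prime_part[OF p, of "order G"] generate_pow_card[OF g(1)] g(2)
      card_subgroup_pos[OF subgroup_self] by (simp add: order_def)
  obtain h where h: "h \<in> carrier G" and hP: "\<And>x. x \<in> P \<Longrightarrow> conj_by h x \<in> generate G {g}"
    using fixed_coset[OF subgroup_self P(1) subgroup.subset[OF P(1)] subgroup_generate[OF g(1)]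
        subgroup.subset[OF subgroup_generate[OF g(1)]] p P(2) cQ] by blast
  have PG: "x \<in> carrier G" if "x \<in> P" for x using subgroup.mem_carrier[OF P(1) that] .
  have pw: "\<exists>i. ord x = p ^ i" if "x \<in> P" for x
    using prime_power_dvdE[OF p] ord_dvd_card[OF P(1) that] P(2) by metis
  have "finite (ord ` P)" "ord ` P \<noteq> {}"
    using finite_subgroup[OF P(1)] subgroup.one_closed[OF P(1)] by auto
  then obtain x where x: "x \<in> P" "\<forall>y\<in>P. ord y \<le> ord x"
    using Max_in[of "ord ` P"] Max_ge[of "ord ` P"] by (metis (no_types, lifting) imageE imageI)
  have "conj_by h y \<in> generate G {conj_by h x}" if y: "y \<in> P" for y
  proof (rule mem_generate_if_ord_dvd[OF g(1) hP[OF y] hP[OF x(1)]])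
    obtain i j where "ord y = p ^ i" "ord x = p ^ j" using pw y x(1) by blast
    moreover have "ord y \<le> ord x" using x(2) y by blast
    ultimately have "ord y dvd ord x"
      using prime_gt_1_nat[OF p] by (simp add: le_imp_power_dvd)
    then show "ord (conj_by h y) dvd ord (conj_by h x)"
      using h PG[OF y] PG[OF x(1)] by (simp add: ord_conj)
  qed
  then have "conj_by h ` P \<subseteq> generate G {conj_by h x}" by (rule image_subsetI)
  moreover have "inj_on (conj_by h) P"
  proof (rule inj_onI)
    fix a b assume "a \<in> P" "b \<in> P" "conj_by h a = conj_by h b"
    then show "a = b" using h PG conj_eq_iff[of h a "conj_by h b"] conj_eq_iff[of h b "conj_by h b"] by simp
  qed
  ultimately have "card P \<le> card (generate G {conj_by h x})"
    using h PG[OF x(1)] by (intro card_inj_on_le[of "conj_by h"]) (auto simp: finite_generate)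
  also have "\<dots> = ord x"
    using generate_pow_card[of "conj_by h x"] h PG[OF x(1)] by (simp add: ord_conj)
  finally have "card P \<le> ord x" .
  moreover have "ord x \<le> card P"
    using ord_dvd_card[OF P(1) x(1)] card_subgroup_pos[OF P(1)] by (rule dvd_imp_le)
  ultimately show ?thesis using that x(1) by simp
qed

text \<open>
  Cyclic Sylow subgroups are inherited by all subgroups: a Sylow subgroup of \<open>H\<close> is a \<open>p\<close>-subgroup of
  the whole group.
\<close>
lemma sylow_element:
  assumes H: "subgroup H G" and p: "prime p"
  obtains g where "g \<in> H" "ord g = p ^ multiplicity p (card H)"
proof -
  define G' where "G' = G\<lparr>carrier := H\<rparr>"
  have "order G' = p ^ multiplicity p (card H) * (card H div p ^ multiplicity p (card H))"
    by (simp add: G'_def order_def multiplicity_dvd)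
  moreover have "group G'" "finite (carrier G')"
    using subgroup_imp_group[OF H] finite_subgroup[OF H] by (simp_all add: G'_def)
  ultimately obtain P where P: "subgroup P G'" "card P = p ^ multiplicity p (card H)"
    using sylow_thm[OF p] by blast
  have "subgroup P G" using P(1) incl_subgroup[OF H] by (simp add: G'_def)
  moreover have "P \<subseteq> H" using subgroup.subset[OF P(1)] by (simp add: G'_def)
  ultimately show ?thesis using p_subgroup_cyclic[OF p _ P(2)] P(2) that by (metis subsetD)
qed

text \<open>
  Both \<open>w\<close> and \<open>y\<close> can be conjugated within \<open>H\<close> into the same cyclic Sylow subgroup, and there
  \<open>w\<close> becomes a power of \<open>y\<close>.
\<close>
lemma conj_into_cyclic:
  assumes H: "subgroup H G" and p: "prime p" and w: "w \<in> H" and y: "y \<in> H"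
    and ow: "ord w dvd ord y" and oy: "ord y = p ^ k"
  obtains h where "h \<in> H" "conj_by h w \<in> generate G {y}"
proof -
  have HG: "x \<in> carrier G" if "x \<in> H" for x using subgroup.mem_carrier[OF H that] .
  obtain g where g: "g \<in> H" "ord g = p ^ multiplicity p (card H)"
    using sylow_element[OF H p] .
  note gG = HG[OF g(1)]
  have cQ: "\<not> p dvd card H div card (generate G {g})"
    using prime_not_dvd_div_prime_part[OF p card_subgroup_pos[OF H]] generate_pow_card[OF gG] g(2) by simp
  have into: "\<exists>h\<in>H. conj_by h x \<in> generate G {g}" if x: "x \<in> H" "ord x = p ^ i" for x i
  proof -
    have "card (generate G {x}) = p ^ i" using generate_pow_card[OF HG[OF x(1)]] x(2) by simp
    then obtain h where "h \<in> H" "\<And>u. u \<in> generate G {x} \<Longrightarrow> conj_by h u \<in> generate G {g}"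
      using fixed_coset[OF H subgroup_generate[OF HG[OF x(1)]] generate_mono_elem[OF H x(1)]
          subgroup_generate[OF gG] generate_mono_elem[OF H g(1)] p _ cQ] by blast
    then show ?thesis using generate_self by blast
  qed
  obtain i where i: "ord w = p ^ i" using prime_power_dvdE[OF p] ow oy by metis
  obtain a where a: "a \<in> H" "conj_by a w \<in> generate G {g}" using into[OF w i] by blast
  obtain b where b: "b \<in> H" "conj_by b y \<in> generate G {g}" using into[OF y oy] by blast
  have "conj_by a w \<in> generate G {conj_by b y}"
    using mem_generate_if_ord_dvd[OF gG a(2) b(2)] ow a(1) b(1) w y HG by (simp add: ord_conj)
  then obtain n :: nat where n: "conj_by a w = conj_by b y [^] n"
    using generate_powers[of "conj_by b y"] b(1) y HG by auto
  have "conj_by (inv b \<otimes> a) w = conj_by (inv b) (conj_by a w)"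
    using a b w HG by (simp add: conj_conj)
  also have "\<dots> = conj_by (inv b) (conj_by b (y [^] n))"
    using n b y HG by (simp add: conj_pow)
  also have "\<dots> = y [^] n" using b y HG by (simp add: conj_conj)
  finally have "conj_by (inv b \<otimes> a) w \<in> generate G {y}"
    using generate_powers[OF HG[OF y]] by simp
  moreover have "inv b \<otimes> a \<in> H" using a b H by (simp add: subgroup.m_closed subgroup.m_inv_closed)
  ultimately show ?thesis using that by blast
qed

end

section \<open>The theorem of Frobenius for cyclic Sylow subgroups\<close>

context finite_Z_group
begin

text \<open>
  If \<open>y\<close> is central in \<open>H\<close>, then being conjugate into \<open>generate G {y}\<close> means lying in it. So the
  elements of order dividing \<open>p ^ Suc j\<close> are the powers of \<open>y\<close>, all of them central, and for
  \<open>i \<le> Suc j\<close> the number of roots for \<open>p ^ i * s\<close> is \<open>p ^ i\<close> times the number of roots for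
  \<open>s\<close>. The case \<open>i = Suc j\<close> then determines the case \<open>i = j\<close>.
\<close>
lemma card_roots_central_p_element:
  assumes H: "subgroup H G" and p: "prime p" and s: "\<not> p dvd s" "s > 0"
    and y: "y \<in> H" "ord y = p ^ Suc j" and central: "centralizer H y = H"
    and top: "card (roots H (p ^ Suc j * s)) = p ^ Suc j * s"
  shows "card (roots H (p ^ j * s)) = p ^ j * s"
proof -
  have HG: "x \<in> carrier G" if "x \<in> H" for x using subgroup.mem_carrier[OF H that] .
  note yG = HG[OF y(1)]
  have sub: "w \<in> generate G {y}" if w: "w \<in> H" "ord w dvd p ^ Suc j" for w
  proof -
    obtain h where h: "h \<in> H" "conj_by h w \<in> generate G {y}"
      using conj_into_cyclic[OF H p w(1) y(1) _ y(2)] w(2) y(2) by auto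
    then obtain n :: nat where n: "conj_by h w = y [^] n" using generate_powers[OF yG] by auto
    have "inv h \<in> centralizer H y" using central h(1) H by (simp add: subgroup.m_inv_closed)
    then have "conj_by (inv h) y = y"
      using HG[OF h(1)] yG by (simp add: centralizer_def conj_fix_iff)
    moreover have "w = conj_by (inv h) (y [^] n)"
      using n conj_eq_iff[of h w "y [^] n"] HG[OF h(1)] HG[OF w(1)] yG by simp
    ultimately have "w = y [^] n" using HG[OF h(1)] yG by (simp add: conj_pow)
    then show ?thesis using generate_powers[OF yG] by simp
  qed
  have count: "card (roots H (p ^ i * s)) = p ^ i * card (roots H s)" if i: "i \<le> Suc j" for i
  proof -
    \<comment> \<open>A power of \<open>y\<close> of order \<open>p ^ i\<close>; its powers are all the roots for \<open>p ^ i\<close>.\<close>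
    define v where "v = y [^] (p ^ (Suc j - i))"
    have p0: "p ^ k > 0" for k using prime_gt_0_nat[OF p] by simp
    have pji: "p ^ Suc j = p ^ (Suc j - i) * p ^ i" using i by (simp flip: power_add)
    have vH: "v \<in> H" using subgroup_nat_pow[OF H y(1)] by (simp add: v_def)
    have ov: "ord v = p ^ i"
      using ord_pow[OF yG, of "p ^ (Suc j - i)"] prime_gt_0_nat[OF p] unfolding y(2) pji v_def by simp
    have "roots H (p ^ i) = generate G {v}"
    proof (intro equalityI subsetI)
      fix w assume "w \<in> roots H (p ^ i)"
      then have w: "w \<in> H" "ord w dvd p ^ i" using H by (auto simp: roots_iff)
      have "ord w dvd p ^ Suc j" unfolding pji using w(2) by (rule dvd_mult)
      moreover have "v \<in> generate G {y}" using generate_powers[OF yG] by (simp add: v_def)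
      ultimately show "w \<in> generate G {v}"
        using mem_generate_if_ord_dvd[OF yG sub[OF w(1)]] w(2) ov by simp
    next
      fix w assume "w \<in> generate G {v}"
      then show "w \<in> roots H (p ^ i)" using generate_subset_roots[OF H vH, of "p ^ i"] ov by auto
    qed
    then have "card (roots H (p ^ i)) = p ^ i"
      using generate_pow_card[OF HG[OF vH]] ov by simp
    moreover have "centralizer H w = H" if w: "w \<in> roots H (p ^ i)" for w
    proof -
      have "w \<in> H" "ord w dvd p ^ Suc j" unfolding pji using w H by (auto simp: roots_iff)
      then obtain n :: nat where n: "w = y [^] n" using sub generate_powers[OF yG] by blast
      have "x \<otimes> w = w \<otimes> x" if x: "x \<in> H" for x
      proof -
        have "conj_by x y = y" using x central HG[OF x] yG by (auto simp: conj_fix_iff centralizer_def)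
        then show ?thesis using HG[OF x] yG n by (simp add: conj_pow flip: conj_fix_iff)
      qed
      then show ?thesis by (auto simp: centralizer_def)
    qed
    moreover have "coprime (p ^ i) s" using prime_imp_coprime[OF p s(1)] by simp
    ultimately show ?thesis
      using card_roots_coprime[OF H, of "p ^ i" s] p0[of i] s(2) by simp
  qed
  have "card (roots H s) = s"
    using count[of "Suc j"] top prime_gt_0_nat[OF p] by simp
  then show ?thesis using count[of j] by simp
qed

text \<open>
  The outer induction is on the order of \<open>H\<close>, the inner one descends from \<open>m = card H\<close> by removing
  one prime at a time. Counting gives \<open>card (roots H m) = m * c\<close> with \<open>c > 0\<close>, and \<open>p - 1\<close> divides the positive number
  \<open>p - c\<close>, which forces \<open>c = 1\<close>.
\<close>
lemma card_roots_top_factor: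
  assumes "subgroup H G" "top_factor m (card H)"
  shows "card (roots H m) = m"
  using assms
proof (induction "card H" arbitrary: H m rule: less_induct)
  case (less H)
  note H = less.prems(1) and smaller = less.hyps
  have HG: "x \<in> carrier G" if "x \<in> H" for x using subgroup.mem_carrier[OF H that] .
  define n where "n = card H"
  have n0: "n > 0" using card_subgroup_pos[OF H] by (simp add: n_def)
  have "top_factor m n \<Longrightarrow> card (roots H m) = m" for m
  proof (induction "n div m" arbitrary: m rule: less_induct)
    case (less m)
    define t where "t = n div m"
    have nmt: "n = m * t" using less.prems by (simp add: top_factor_def t_def)
    have m0: "m > 0" and t0: "t > 0" using nmt n0 by auto
    have top: "r \<le> q" if "prime q" "q dvd m" "prime r" "r dvd t" for q r
      using less.prems that by (auto simp: top_factor_def t_def)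
    show ?case
    proof (cases "t = 1")
      case True
      then show ?thesis using nmt roots_card[OF H] by (simp add: n_def)
    next
      case False
      obtain p where p: "prime p" "p dvd t" and pmax: "\<And>r. \<lbrakk>prime r; r dvd t\<rbrakk> \<Longrightarrow> r \<le> p"
        using largest_prime_divisor[OF False t0] by blast
      obtain t' where t': "t = p * t'" using p(2) by blast
      \<comment> \<open>The largest prime factor of the cofactor is moved to the other side.\<close>
      have "top_factor (m * p) n"
      proof (rule top_factorI[of _ _ t' p])
        show "n = m * p * t'" using nmt t' by simp
        show "m * p > 0" using m0 prime_gt_0_nat[OF p(1)] by simp
        show "p \<le> q" if "prime q" "q dvd m * p" for q
          using that top[OF that(1) _ p] p(1) by (auto simp: prime_dvd_mult_iff dest: primes_dvd_imp_eq)
        show "r \<le> p" if "prime r" "r dvd t'" for r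
          using pmax[of r] that t' by auto
      qed
      moreover have "n div (m * p) < n div m"
        using nmt t' m0 t0 prime_gt_1_nat[OF p(1)] by auto
      ultimately have IH: "card (roots H (m * p)) = m * p" using less.hyps by blast
      obtain s where s: "m = p ^ multiplicity p m * s" "\<not> p dvd s"
        using multiplicity_decompose'[of m p] m0 not_prime_unit[of p] p(1) by blast
      define j where "j = multiplicity p m"
      note mj = s(1)[folded j_def]
      have mp: "m * p = p ^ Suc j * s" using mj by simp
      have s0: "s > 0" using mj m0 by (cases s) auto
      \<comment> \<open>The elements that are lost on passing from \<open>m * p\<close> to \<open>m\<close> have a \<open>p\<close>-part of order \<open>p ^ Suc j\<close>.\<close>
      define S where "S = roots H (p ^ Suc j * s) - roots H (p ^ j * s)"
      have finS: "finite S" using finite_roots[OF H] by (simp add: S_def)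
      have subm: "roots H (p ^ j * s) \<subseteq> roots H (p ^ Suc j * s)"
        by (rule roots_mono[OF H]) simp
      have cS: "card S = m * p - card (roots H m)"
        unfolding S_def card_Diff_subset[OF finite_roots[OF H] subm] IH[unfolded mp] mp
        by (simp only: mj[symmetric])
      have le: "card (roots H m) \<le> m * p"
        using card_mono[OF finite_roots[OF H] subm] unfolding IH[unfolded mp] mp mj[symmetric] .
      have pS: "p ^ j * (p - 1) dvd card S"
        unfolding S_def by (rule totient_dvd_card_roots_diff[OF H p(1) s(2)])
      show ?thesis
      proof (cases "\<exists>y\<in>H. ord y = p ^ Suc j \<and> centralizer H y = H")
        case True
        then show ?thesis
          using card_roots_central_p_element[OF H p(1) s(2) s0 _ _ _ IH[unfolded mp]]
          unfolding mj[symmetric] by blast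
      next
        case False
        have sn: "n = s * (p ^ j * t)" using nmt mj by (simp add: mult_ac)
        have co: "coprime (p ^ k) s" for k using prime_imp_coprime[OF p(1) s(2)] by simp
        \<comment> \<open>\<open>Y\<close> is the set of these \<open>p\<close>-parts; all their centralizers are proper subgroups of \<open>H\<close>.\<close>
        define Y where "Y = roots H (p ^ Suc j) - roots H (p ^ j)"
        have Ysub: "roots H (p ^ j) \<subseteq> roots H (p ^ Suc j)"
          by (rule roots_mono[OF H]) simp
        have YH: "y \<in> H \<and> ord y = p ^ Suc j" if "y \<in> Y" for y
        proof -
          have y: "y \<in> H" "ord y dvd p ^ Suc j" "\<not> ord y dvd p ^ j"
            using that H by (auto simp: Y_def roots_iff)
          obtain i where i: "i \<le> Suc j" "ord y = p ^ i" using prime_power_dvdE[OF p(1) y(2)] .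
          have "\<not> i \<le> j" using y(3) i(2) le_imp_power_dvd by auto
          then show ?thesis using i y(1) by (simp add: le_Suc_eq)
        qed
        have "s dvd (\<Sum>y\<in>Y. card (roots (centralizer H y) s))"
        proof (rule dvd_sum_card_roots_centralizer[OF H])
          show "s dvd card H" using sn by (simp add: n_def)
          show "Y \<subseteq> H" using YH by blast
          show "conj_by h y \<in> Y" if hy: "h \<in> H" "y \<in> Y" for h y
          proof -
            have "ord (conj_by h y) = ord y" using hy YH HG by (simp add: ord_conj)
            then show ?thesis using hy YH[OF hy(2)] conj_in_subgroup[OF H hy(1)] H
              by (auto simp: Y_def roots_iff)
          qed
          fix y assume y: "y \<in> Y"
          let ?C = "centralizer H y"
          have C: "subgroup ?C G" using subgroup_centralizer[OF H] YH[OF y] HG by blast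
          have "?C \<subseteq> H" by (auto simp: centralizer_def)
          moreover have "?C \<noteq> H" using False YH[OF y] by blast
          ultimately have CH: "?C \<subset> H" by blast
          then have less': "card ?C < card H" using finite_subgroup[OF H] by (intro psubset_card_mono)
          have "card ?C dvd s * (p ^ j * t)"
            using card_dvd_card[OF C H] CH sn by (simp add: n_def psubset_eq)
          define g where "g = gcd s (card ?C)"
          have "card ?C div g dvd p ^ j * t"
            unfolding g_def using \<open>card ?C dvd s * (p ^ j * t)\<close> s0 by (rule div_gcd_dvd_cofactor)
          \<comment> \<open>Prime factors of \<open>g\<close> divide \<open>m\<close>, so they are at least \<open>p\<close>; those of the cofactor divide \<open>p ^ j * t\<close>, so they are at most \<open>p\<close>.\<close>
          have "top_factor g (card ?C)"
          proof (rule top_factorI[of _ _ "card ?C div g" p])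
            show "card ?C = g * (card ?C div g)" by (simp add: g_def)
            show "g > 0" using s0 by (simp add: g_def)
            show "p \<le> q" if "prime q" "q dvd g" for q
            proof -
              have "q dvd m" using that(2) mj by (auto simp: g_def)
              then show ?thesis using top[OF that(1) _ p] by blast
            qed
            show "r \<le> p" if "prime r" "r dvd card ?C div g" for r
            proof -
              have "r dvd p ^ j * t" using that(2) \<open>card ?C div g dvd p ^ j * t\<close> by (rule dvd_trans)
              then have "r dvd p \<or> r dvd t"
                using that(1) by (auto simp: prime_dvd_mult_iff dest: prime_dvd_power)
              then show ?thesis using pmax[OF that(1)] p(1) that(1) by (auto dest: primes_dvd_imp_eq)
            qed
          qed
          then have "card (roots ?C g) = g" using smaller[OF less' C] by blast
          then show "gcd s (card ?C) dvd card (roots ?C s)"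
            using roots_gcd[OF C, of s] by (simp add: g_def)
        qed
        also have "(\<Sum>y\<in>Y. card (roots (centralizer H y) s)) = card S"
        proof -
          have p0: "p ^ k > 0" for k using prime_gt_0_nat[OF p(1)] by simp
          show ?thesis
            unfolding S_def Y_def card_Diff_subset[OF finite_roots[OF H] subm]
              card_roots_coprime[OF H co p0 s0]
            using sum_diff_nat[OF finite_roots[OF H] Ysub] by simp
        qed
        finally have sS: "s dvd card S" .
        then have mS: "m dvd card S"
          unfolding mj using co[of j] dvd_mult_left[OF pS] by (intro divides_mult)
        have "m dvd card (roots H m)"
        proof -
          have "card (roots H m) = m * p - card S" using cS le by simp
          then show ?thesis using mS by simp
        qed
        then obtain c where c: "card (roots H m) = m * c" by blast
        have "\<one> \<in> roots H m" using subgroup.one_closed[OF H] by (simp add: roots_def)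
        then have c0: "c > 0" using c finite_roots[OF H, of m] by (cases c) auto
        have cS': "card S = m * (p - c)" using cS c by (simp add: right_diff_distrib')
        \<comment> \<open>All prime factors of \<open>m\<close> are at least \<open>p\<close>.\<close>
        have "coprime m (p - 1)"
        proof (rule ccontr)
          assume "\<not> coprime m (p - 1)"
          then have "gcd m (p - 1) \<noteq> 1" by (simp add: coprime_iff_gcd_eq_1)
          then obtain q where "prime q" "q dvd gcd m (p - 1)" using prime_factor_nat by blast
          then have q: "prime q" "q dvd m" "q dvd p - 1" by simp_all
          have "q \<le> p - 1" using q(3) prime_gt_1_nat[OF p(1)] by (intro dvd_imp_le) auto
          moreover have "p \<le> q" using top[OF q(1,2) p] .
          ultimately show False using prime_gt_1_nat[OF p(1)] by simp
        qed
        moreover have "p - 1 dvd m * (p - c)" using dvd_mult_right[OF pS] cS' by simp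
        ultimately have dvd: "p - 1 dvd p - c"
          by (simp add: coprime_commute coprime_dvd_mult_right_iff)
        \<comment> \<open>A cyclic Sylow \<open>p\<close>-subgroup of \<open>H\<close> has elements of order \<open>p ^ Suc j\<close>.\<close>
        have "S \<noteq> {}"
        proof -
          obtain g where g: "g \<in> H" "ord g = p ^ multiplicity p (card H)"
            using sylow_element[OF H p(1)] .
          have "p ^ Suc j dvd n" using nmt t' mj by (auto simp: mult_ac)
          then have ja: "Suc j \<le> multiplicity p n"
            using n0 p(1) not_prime_unit[of p] power_dvd_iff_le_multiplicity[of n p "Suc j"] by blast
          define x where "x = g [^] (p ^ (multiplicity p n - Suc j))"
          have xH: "x \<in> H" using subgroup_nat_pow[OF H g(1)] by (simp add: x_def)
          have pa: "p ^ multiplicity p n = p ^ (multiplicity p n - Suc j) * p ^ Suc j"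
            using ja by (simp flip: power_add power_Suc)
          have "ord x = p ^ Suc j"
            using ord_pow[OF HG[OF g(1)], of "p ^ (multiplicity p n - Suc j)"] prime_gt_0_nat[OF p(1)]
            unfolding g(2) n_def[symmetric] pa x_def by simp
          moreover have "\<not> p ^ Suc j dvd p ^ j * s"
            using s(2) prime_gt_0_nat[OF p(1)] by simp
          ultimately have "x \<in> S" unfolding S_def using xH H by (simp add: roots_iff)
          then show ?thesis by blast
        qed
        then have "card S > 0" using finS by (simp add: card_gt_0_iff)
        then have "p - c > 0" using cS' by simp
        then have "p - 1 \<le> p - c" using dvd by (rule dvd_imp_le[rotated])
        then have "c = 1" using c0 \<open>p - c > 0\<close> by simp
        then show ?thesis using c by simp
      qed
    qed
  qed
  then show ?case using less.prems(2) by (simp add: n_def)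
qed

end

section \<open>Two generators\<close>

context finite_Z_group
begin

text \<open>
  If an element \<open>y\<close> of largest order does not generate, some prime \<open>p\<close> has a higher power in the group order
  than in \<open>ord y\<close>. Exchanging the \<open>p\<close>-part of \<open>y\<close> for a generator of a Sylow \<open>p\<close>-subgroup gives an element of larger
  order.
\<close>
lemma abelian_imp_generator:
  assumes comm: "\<And>x y. \<lbrakk>x \<in> carrier G; y \<in> carrier G\<rbrakk> \<Longrightarrow> x \<otimes> y = y \<otimes> x"
  obtains y where "y \<in> carrier G" "generate G {y} = carrier G"
proof -
  have "finite (ord ` carrier G)" "ord ` carrier G \<noteq> {}" by auto
  then have "Max (ord ` carrier G) \<in> ord ` carrier G" by (rule Max_in)
  then obtain y where y: "y \<in> carrier G" "Max (ord ` carrier G) = ord y" by (rule imageE) auto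
  have max: "ord z \<le> ord y" if "z \<in> carrier G" for z
    using Max_ge[of "ord ` carrier G" "ord z"] that y(2) by simp
  have ny: "ord y dvd order G" using ord_dvd_group_order[OF y(1)] .
  have n0: "order G > 0" using card_subgroup_pos[OF subgroup_self] by (simp add: order_def)
  have "ord y = order G"
  proof (rule ccontr)
    assume ne: "ord y \<noteq> order G"
    obtain k where k: "order G = ord y * k" using ny by blast
    then have "k \<noteq> 1" using ne by auto
    then obtain p where p: "prime p" "p dvd k" using prime_factor_nat by blast
    define b where "b = multiplicity p (ord y)"
    obtain m where m: "ord y = p ^ b * m" "\<not> p dvd m"
      using multiplicity_decompose'[of "ord y" p] ord_pos[OF y(1)] not_prime_unit[of p] p(1)
      unfolding b_def by blast
    obtain g where g: "g \<in> carrier G" "ord g = p ^ multiplicity p (order G)"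
      using cyclic_sylow[OF p(1)] by blast
    have "p ^ Suc b dvd order G"
      using p(2) k m(1) by (auto simp: mult_ac)
    then have a: "Suc b \<le> multiplicity p (order G)"
      using n0 p(1) not_prime_unit[of p] power_dvd_iff_le_multiplicity[of "order G" p "Suc b"] by blast
    define z where "z = y [^] (p ^ b)"
    have z: "z \<in> carrier G" "ord z = m"
      using ord_pow[OF y(1), of "p ^ b"] m(1) prime_gt_0_nat[OF p(1)] y(1) by (simp_all add: z_def)
    have "coprime (ord g) (ord z)"
      unfolding g(2) z(2) using prime_imp_coprime[OF p(1) m(2)] by simp
    then have "ord (g \<otimes> z) = p ^ multiplicity p (order G) * m"
      using ord_mult_coprime[OF g(1) z(1)] comm g z by simp
    moreover have "p ^ b * m < p ^ multiplicity p (order G) * m"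
      using a prime_gt_1_nat[OF p(1)] m ord_pos[OF y(1)] by (auto intro!: power_strict_increasing)
    ultimately show False using max[of "g \<otimes> z"] g(1) z(1) m(1) by simp
  qed
  then have "generate G {y} = carrier G"
    using generate_pow_card[OF y(1)] generate_mono_elem[OF subgroup_self y(1)]
    by (intro card_subset_eq) (auto simp: order_def)
  then show ?thesis using that y(1) by blast
qed

text \<open>
  The image of a Sylow generator \<open>g\<close> has an order \<open>p ^ i\<close> that divides the order of the quotient,
  while \<open>g [^] (p ^ i)\<close> lies in \<open>N\<close>, so its order divides that of \<open>N\<close>. The exponents add up, so both divisors
  are full \<open>p\<close>-parts.
\<close>
lemma quotient_finite_Z_group:
  assumes "N \<lhd> G"
  shows "finite_Z_group (G Mod N)"
proof -
  interpret N: normal N G by fact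
  interpret K: group "G Mod N" by (rule N.factorgroup_is_group)
  have fin: "finite (carrier (G Mod N))" by (simp add: carrier_FactGroup)
  interpret K: finite_group "G Mod N" by unfold_locales (rule fin)
  have ordK: "order G = order (G Mod N) * card N"
    using lagrange[OF N.subgroup_axioms] by (simp add: order_def FactGroup_def)
  show ?thesis
  proof unfold_locales
    fix p :: nat assume p: "prime p"
    obtain g where g: "g \<in> carrier G" "ord g = p ^ multiplicity p (order G)"
      using cyclic_sylow[OF p] by blast
    define X where "X = N #> g"
    have X: "X \<in> carrier (G Mod N)" using g(1) by (auto simp: X_def carrier_FactGroup)
    have powX: "X [^]\<^bsub>G Mod N\<^esub> k = N #> (g [^] k)" for k :: nat
      unfolding X_def by (rule N.FactGroup_pow[OF g(1)])
    have pos: "order (G Mod N) > 0" "card N > 0"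
      using K.order_gt_0_iff_finite fin card_subgroup_pos[OF N.subgroup_axioms] by auto
    have mult: "multiplicity p (order G) = multiplicity p (order (G Mod N)) + multiplicity p (card N)"
      unfolding ordK using pos p by (intro prime_elem_multiplicity_mult_distrib) auto
    have "X [^]\<^bsub>G Mod N\<^esub> ord g = \<one>\<^bsub>G Mod N\<^esub>"
      using powX[of "ord g"] g(1) coset_mult_one[OF N.subset] by simp
    then have "K.ord X dvd p ^ multiplicity p (order G)"
      using K.pow_eq_id[OF X] g(2) by simp
    then obtain i where i: "i \<le> multiplicity p (order G)" "K.ord X = p ^ i"
      using prime_power_dvdE[OF p] by blast
    have "p ^ i dvd order (G Mod N)" using K.ord_dvd_group_order[OF X] i(2) by simp
    then have i1: "i \<le> multiplicity p (order (G Mod N))"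
      using power_dvd_iff_le_multiplicity[of "order (G Mod N)" p i] pos(1) not_prime_unit[of p] p by blast
    have "N #> (g [^] (p ^ i)) = N"
      using K.pow_ord_eq_1[OF X] powX[of "p ^ i"] i(2) by simp
    then have gN: "g [^] (p ^ i) \<in> N"
      using coset_join1[of N "g [^] (p ^ i)"] g(1) N.subgroup_axioms N.subset by simp
    have "ord (g [^] (p ^ i)) = p ^ (multiplicity p (order G) - i)"
      using ord_pow[OF g(1), of "p ^ i"] g(2) i(1) prime_gt_0_nat[OF p]
      by (simp add: le_imp_power_dvd power_diff)
    then have "p ^ (multiplicity p (order G) - i) dvd card N"
      using ord_dvd_card[OF N.subgroup_axioms gN] by simp
    then have "multiplicity p (order G) - i \<le> multiplicity p (card N)"
      using power_dvd_iff_le_multiplicity[of "card N" p "multiplicity p (order G) - i"] pos(2) not_prime_unit[of p] p by blast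
    then have "i = multiplicity p (order (G Mod N))" using i1 i(1) mult by simp
    then show "\<exists>g\<in>carrier (G Mod N). K.ord g = p ^ multiplicity p (order (G Mod N))"
      using X i(2) by blast
  qed
qed

text \<open>
  Take \<open>x\<close> of largest order among the generators of normal cyclic subgroups, and suppose that its
  centralizer \<open>C\<close> is larger than \<open>generate G {x}\<close>. Let \<open>q\<close> be the largest prime factor of the index, and split
  \<open>ord x = s * q ^ b * t\<close> into the parts above, at and below \<open>q\<close>. Then \<open>s * q ^ (b + c)\<close> is a top
  factor of \<open>card C\<close> for some \<open>c > 0\<close>, and \<open>C\<close> contains an element \<open>v\<close> of that order. The roots
  in \<open>C\<close> that belong to it are exactly the powers of \<open>v\<close>, so \<open>v\<close> generates a normal subgroup. Together with the
  part \<open>w\<close> of \<open>x\<close> of order \<open>t\<close> it gives a normal cyclic subgroup of larger order.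
\<close>
lemma self_centralizing_normal_cyclic:
  obtains x where "x \<in> carrier G" "\<And>c. c \<in> carrier G \<Longrightarrow> conj_by c x \<in> generate G {x}"
    "centralizer (carrier G) x = generate G {x}"
proof -
  define S where "S = {x \<in> carrier G. \<forall>c\<in>carrier G. conj_by c x \<in> generate G {x}}"
  have "\<one> \<in> S" by (auto simp: S_def intro: generate_self)
  then have fin: "finite (ord ` S)" "ord ` S \<noteq> {}" by (auto simp: S_def)
  then have "Max (ord ` S) \<in> ord ` S" by (rule Max_in)
  then obtain x where x: "x \<in> S" "Max (ord ` S) = ord x" by (rule imageE) auto
  have max: "ord z \<le> ord x" if "z \<in> S" for z
    using Max_ge[OF fin(1) imageI[OF that]] x(2) by simp
  have xG: "x \<in> carrier G" and xn: "\<And>c. c \<in> carrier G \<Longrightarrow> conj_by c x \<in> generate G {x}"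
    using x(1) by (auto simp: S_def)
  define C where "C = centralizer (carrier G) x"
  have C: "subgroup C G" unfolding C_def by (rule subgroup_centralizer[OF subgroup_self xG])
  have CG: "a \<in> carrier G \<and> a \<otimes> x = x \<otimes> a" if "a \<in> C" for a using that by (auto simp: C_def centralizer_def)
  have xC: "x \<in> C" using xG by (simp add: C_def centralizer_def)
  have Cn: "conj_by c a \<in> C" if c: "c \<in> carrier G" and a: "a \<in> C" for c a
  proof -
    obtain k :: nat where k: "conj_by (inv c) x = x [^] k"
      using xn[of "inv c"] c generate_powers[OF xG] by auto
    have "a \<otimes> conj_by (inv c) x = conj_by (inv c) x \<otimes> a"
      unfolding k using commute_pow CG[OF a] xG by blast
    then have "conj_by c (a \<otimes> conj_by (inv c) x) = conj_by c (conj_by (inv c) x \<otimes> a)" by simp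
    then have "conj_by c a \<otimes> x = x \<otimes> conj_by c a"
      using c CG[OF a] xG by (simp add: conj_mult conj_conj)
    then show ?thesis using c CG[OF a] by (simp add: C_def centralizer_def)
  qed
  have sub: "generate G {x} \<subseteq> C" using generate_mono_elem[OF C xC] .
  have "generate G {x} = C"
  proof (rule ccontr)
    assume ne: "generate G {x} \<noteq> C"
    have dvd: "ord x dvd card C" using ord_dvd_card[OF C xC] .
    then obtain k where k: "card C = ord x * k" by blast
    have k1: "k \<noteq> 1"
      using k ne card_subset_eq[OF finite_subgroup[OF C] sub] generate_pow_card[OF xG] by auto
    have k0: "k > 0" using k card_subgroup_pos[OF C] by (cases k) auto
    obtain q where q: "prime q" "q dvd k" and qmax: "\<And>r. \<lbrakk>prime r; r dvd k\<rbrakk> \<Longrightarrow> r \<le> q"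
      using largest_prime_divisor[OF k1 k0] by blast
    obtain s b t where ox: "ord x = s * q ^ b * t" and st: "s > 0" "t > 0"
      and sq: "\<And>r. \<lbrakk>prime r; r dvd s\<rbrakk> \<Longrightarrow> q < r" and tq: "\<And>r. \<lbrakk>prime r; r dvd t\<rbrakk> \<Longrightarrow> r < q"
      using split_at_prime[OF q(1) ord_pos[OF xG]] by blast
    define c where "c = multiplicity q k"
    obtain k' where k': "k = q ^ c * k'" "\<not> q dvd k'"
      using multiplicity_decompose'[of k q] k0 not_prime_unit[of q] q(1) unfolding c_def by blast
    have c0: "c > 0" using k' q(2) by (cases c) auto
    have q0: "q > 0" using prime_gt_0_nat[OF q(1)] .
    have n: "card C = s * q ^ (b + c) * (t * k')" by (simp add: k ox k' power_add mult_ac)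
    have top: "top_factor (s * q ^ (b + c)) (card C)"
    proof (rule top_factorI[OF n, of q])
      show "s * q ^ (b + c) > 0" using st q0 by simp
      show "q \<le> r" if r: "prime r" "r dvd s * q ^ (b + c)" for r
      proof -
        have "r dvd s \<or> r dvd q" using r by (auto simp: prime_dvd_mult_iff dest: prime_dvd_power)
        then show ?thesis using sq[OF r(1)] primes_dvd_imp_eq[OF r(1) q(1)] by auto
      qed
      show "r \<le> q" if r: "prime r" "r dvd t * k'" for r
        using r tq[OF r(1)] qmax[OF r(1)] k'(1) by (auto simp: prime_dvd_mult_iff less_imp_le)
    qed
    have "\<not> q dvd s * (t * k')"
      using sq[OF q(1)] tq[OF q(1)] k'(2) q(1) by (auto simp: prime_dvd_mult_iff)
    then have mq: "multiplicity q (card C) = b + c"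
      unfolding n using q0 by (intro multiplicity_eqI) (auto simp: mult_ac)
    obtain g where g: "g \<in> C" "ord g = q ^ (b + c)" using sylow_element[OF C q(1)] mq by metis
    \<comment> \<open>The part of \<open>x\<close> of order \<open>s\<close>, times a Sylow generator of \<open>C\<close> at \<open>q\<close>.\<close>
    define u where "u = x [^] (q ^ b * t)"
    have uG: "u \<in> carrier G" using xG by (simp add: u_def)
    have ou: "ord u = s" using ord_pow[OF xG, of "q ^ b * t"] ox st q0 by (simp add: u_def mult_ac)
    have uC: "u \<in> C" using subgroup_nat_pow[OF C xC] by (simp add: u_def)
    have gG: "g \<in> carrier G" using CG[OF g(1)] by simp
    have ug: "u \<otimes> g = g \<otimes> u" unfolding u_def using commute_pow[OF gG xG] CG[OF g(1)] by simp
    have "\<not> q dvd s" using sq[OF q(1)] by blast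
    then have "coprime q s" by (rule prime_imp_coprime[OF q(1)])
    then have co1: "coprime s (q ^ (b + c))" by (simp add: coprime_commute)
    define v where "v = u \<otimes> g"
    have vC: "v \<in> C" unfolding v_def using subgroup.m_closed[OF C uC g(1)] .
    have vG: "v \<in> carrier G" using CG[OF vC] by simp
    have ov: "ord v = s * q ^ (b + c)"
      unfolding v_def using ord_mult_coprime[OF uG gG ug] ou g(2) co1 by simp
    have roots: "roots C (s * q ^ (b + c)) = generate G {v}"
      by (rule roots_eq_generate[OF C vC ov card_roots_top_factor[OF C top]])
    define w where "w = x [^] (s * q ^ b)"
    have wG: "w \<in> carrier G" using xG by (simp add: w_def)
    have ow: "ord w = t" using ord_pow[OF xG, of "s * q ^ b"] ox st q0 by (simp add: w_def mult_ac)
    have vw: "v \<otimes> w = w \<otimes> v" unfolding w_def using commute_pow[OF vG xG] CG[OF vC] by simp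
    have co2: "coprime (ord v) (ord w)"
      unfolding ov ow
    proof (rule coprime_natI)
      fix r assume r: "prime r" "r dvd s * q ^ (b + c)" "r dvd t"
      have "r dvd s \<or> r dvd q" using r by (auto simp: prime_dvd_mult_iff dest: prime_dvd_power)
      then show False using sq[OF r(1)] tq[OF r(1,3)] primes_dvd_imp_eq[OF r(1) q(1)] by auto
    qed
    define z where "z = v \<otimes> w"
    have zG: "z \<in> carrier G" using vG wG by (simp add: z_def)
    have oz: "ord z = s * q ^ (b + c) * t"
      unfolding z_def using ord_mult_coprime[OF vG wG vw co2] ov ow by simp
    have vz: "v \<in> generate G {z}"
      unfolding z_def by (rule left_factor_mem_generate[OF vG wG vw co2])
    have wz: "w \<in> generate G {z}"
      unfolding z_def vw by (rule left_factor_mem_generate[OF wG vG vw[symmetric]]) (use co2 in \<open>simp add: coprime_commute\<close>)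
    have "z \<in> S"
    proof -
      have "conj_by a z \<in> generate G {z}" if a: "a \<in> carrier G" for a
      proof -
        have "conj_by a v \<in> roots C (s * q ^ (b + c))"
          using Cn[OF a vC] ord_conj[OF a vG] ov C by (simp add: roots_iff)
        then have "conj_by a v \<in> generate G {z}"
          using roots generate_mono_elem[OF subgroup_generate[OF zG] vz] by blast
        moreover have "conj_by a w \<in> generate G {z}"
        proof -
          obtain l :: nat where l: "conj_by a x = x [^] l"
            using xn[OF a] generate_powers[OF xG] by auto
          have "conj_by a w = w [^] l"
            unfolding w_def using a xG l by (simp add: conj_pow nat_pow_pow mult.commute)
          then show ?thesis using subgroup_nat_pow[OF subgroup_generate[OF zG] wz] by simp
        qed
        ultimately show ?thesis
          unfolding z_def using a vG wG subgroup.m_closed[OF subgroup_generate[OF zG]]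
          by (simp add: conj_mult z_def)
      qed
      then show ?thesis using zG by (simp add: S_def)
    qed
    then have "ord z \<le> ord x" by (rule max)
    moreover have "ord x < ord z"
      unfolding oz ox using c0 st prime_gt_1_nat[OF q(1)] one_less_power[of q c] by (simp add: power_add)
    ultimately show False by simp
  qed
  then show ?thesis using that xG xn C_def by blast
qed

text \<open>
  The self-centralizing normal cyclic subgroup contains all commutators, since conjugation acts on a
  cyclic group by taking powers, and powers commute. Modulo this subgroup, a single generator is left.
\<close>
lemma two_generators:
  obtains x y where "x \<in> carrier G" "y \<in> carrier G"
    "\<And>g. g \<in> carrier G \<Longrightarrow> \<exists>i j. g = x [^] (i::nat) \<otimes> y [^] (j::nat)"
proof -
  obtain x where x: "x \<in> carrier G" and xn: "\<And>c. c \<in> carrier G \<Longrightarrow> conj_by c x \<in> generate G {x}"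
    and cent: "centralizer (carrier G) x = generate G {x}"
    using self_centralizing_normal_cyclic by blast
  define A where "A = generate G {x}"
  have powA: "a \<in> A \<longleftrightarrow> (\<exists>k::nat. a = x [^] k)" for a
    using generate_powers[OF x] by (auto simp: A_def)
  have pow: "\<exists>k::nat. conj_by c x = x [^] k" if "c \<in> carrier G" for c
    using xn[OF that] powA by (simp add: A_def)
  have A: "subgroup A G" unfolding A_def by (rule subgroup_generate[OF x])
  have closed: "conj_by c h \<in> A" if c: "c \<in> carrier G" and h: "h \<in> A" for c h
  proof -
    obtain k :: nat where "h = x [^] k" using h powA by blast
    then have "conj_by c h = conj_by c x [^] k" using c x by (simp add: conj_pow)
    then show ?thesis using subgroup_nat_pow[OF A] xn[OF c] by (simp add: A_def)
  qed
  have "A \<lhd> G" unfolding normal_inv_iff using A closed by (simp add: conj_by_def)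
  then interpret A: normal A G .
  interpret K: finite_Z_group "G Mod A" by (rule quotient_finite_Z_group[OF \<open>A \<lhd> G\<close>])
  have comm: "A #> (a \<otimes> b) = A #> (b \<otimes> a)" if ab: "a \<in> carrier G" "b \<in> carrier G" for a b
  proof -
    obtain i j :: nat where ij: "conj_by a x = x [^] i" "conj_by b x = x [^] j"
      using pow ab by blast
    have "conj_by (a \<otimes> b) x = conj_by a (x [^] j)" using ab x ij(2) by (simp flip: conj_conj)
    also have "\<dots> = conj_by b (x [^] i)"
      using ab x ij by (simp add: conj_pow nat_pow_pow mult.commute)
    also have "\<dots> = conj_by (b \<otimes> a) x" using ab x ij(1) by (simp flip: conj_conj)
    finally have eq: "conj_by (a \<otimes> b) x = conj_by (b \<otimes> a) x" .
    \<comment> \<open>The two products act alike on \<open>x\<close>, so they differ by an element of the centralizer, that is, of \<open>A\<close>.\<close>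
    define e where "e = inv (b \<otimes> a) \<otimes> (a \<otimes> b)"
    have eG: "e \<in> carrier G" using ab by (simp add: e_def)
    have "conj_by e x = conj_by (inv (b \<otimes> a)) (conj_by (a \<otimes> b) x)"
      unfolding e_def using ab x by (simp add: conj_conj)
    also have "\<dots> = x" unfolding eq using ab x by (simp add: conj_conj)
    finally have "e \<in> A"
      using cent eG x by (auto simp: A_def centralizer_def conj_fix_iff)
    then have d: "conj_by (b \<otimes> a) e \<in> A" using closed ab by simp
    have "conj_by (b \<otimes> a) e \<otimes> (b \<otimes> a) = (b \<otimes> a) \<otimes> e" using ab eG by (simp add: conj_by_def m_assoc)
    also have "\<dots> = a \<otimes> b" unfolding e_def using ab by (simp flip: m_assoc)
    finally have "A #> (a \<otimes> b) = (A #> conj_by (b \<otimes> a) e) #> (b \<otimes> a)"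
      using coset_mult_assoc[OF A.subset, of "conj_by (b \<otimes> a) e" "b \<otimes> a"] ab eG by simp
    also have "A #> conj_by (b \<otimes> a) e = A" using d ab eG by (intro coset_join2[OF _ A]) auto
    finally show ?thesis .
  qed
  have "X \<otimes>\<^bsub>G Mod A\<^esub> Y = Y \<otimes>\<^bsub>G Mod A\<^esub> X" if XY: "X \<in> carrier (G Mod A)" "Y \<in> carrier (G Mod A)" for X Y
  proof -
    obtain a b where "a \<in> carrier G" "b \<in> carrier G" "X = A #> a" "Y = A #> b"
      using XY by (auto simp: carrier_FactGroup)
    then show ?thesis using comm[of a b] by (simp add: A.rcos_sum)
  qed
  then obtain Y where Y: "Y \<in> carrier (G Mod A)" "generate (G Mod A) {Y} = carrier (G Mod A)"
    using K.abelian_imp_generator by blast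
  obtain y where y: "y \<in> carrier G" "Y = A #> y" using Y(1) by (auto simp: carrier_FactGroup)
  have "\<exists>i j. g = x [^] (i::nat) \<otimes> y [^] (j::nat)" if g: "g \<in> carrier G" for g
  proof -
    have "A #> g \<in> generate (G Mod A) {Y}" unfolding Y(2) using g by (simp add: carrier_FactGroup)
    then obtain n :: nat where "A #> g = Y [^]\<^bsub>G Mod A\<^esub> n"
      using K.generate_powers[OF Y(1)] by auto
    then have "A #> g = A #> (y [^] n)" using A.FactGroup_pow[OF y(1)] y(2) by simp
    then have "g \<in> A #> (y [^] n)" using rcos_self[OF g A] by simp
    then obtain a where a: "a \<in> A" "g = a \<otimes> y [^] n" by (auto simp: r_coset_def)
    then obtain i :: nat where "a = x [^] i" using powA by blast
    then show ?thesis using a(2) by auto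
  qed
  then show ?thesis using that x y(1) by blast
qed

end

section \<open>The cyclic graph\<close>

text \<open>
  Paths of length at most 2 spelled out. If the intermediate vertex coincides with an end, one of the
  two arcs is already a path.
\<close>
lemma diameter_le_2_iff:
  assumes "wf_digraph (with_proj P)"
  shows "diameter (with_proj P) \<le> 2 \<longleftrightarrow>
    (\<forall>u\<in>pverts P. \<forall>v\<in>pverts P. u = v \<or> (u, v) \<in> parcs P \<or> (\<exists>z. (u, z) \<in> parcs P \<and> (z, v) \<in> parcs P))"
proof -
  interpret wf_digraph "with_proj P" by fact
  have "(\<exists>p. apath u p v \<and> length p \<le> 2) \<longleftrightarrow>
      u = v \<or> (u, v) \<in> parcs P \<or> (\<exists>z. (u, z) \<in> parcs P \<and> (z, v) \<in> parcs P)"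
    if uv: "u \<in> pverts P" "v \<in> pverts P" for u v
  proof
    assume "\<exists>p. apath u p v \<and> length p \<le> 2"
    then obtain p where p: "awalk u p v" "length p \<le> 2" by (auto simp: apath_def)
    consider "p = []" | e where "p = [e]" | e f where "p = [e, f]"
      using p(2) by (cases p rule: remdups_adj.cases) auto
    then show "u = v \<or> (u, v) \<in> parcs P \<or> (\<exists>z. (u, z) \<in> parcs P \<and> (z, v) \<in> parcs P)"
      by cases (use p in \<open>auto simp: awalk_def\<close>)
  next
    assume "u = v \<or> (u, v) \<in> parcs P \<or> (\<exists>z. (u, z) \<in> parcs P \<and> (z, v) \<in> parcs P)"
    then consider "u = v" | "u \<noteq> v" "(u, v) \<in> parcs P"
      | z where "u \<noteq> v" "z \<noteq> u" "z \<noteq> v" "(u, z) \<in> parcs P" "(z, v) \<in> parcs P" by metis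
    then show "\<exists>p. apath u p v \<and> length p \<le> 2"
    proof cases
      case 1
      then show ?thesis using uv by (intro exI[of _ "[]"]) (simp add: apath_def awalk_def)
    next
      case 2
      then show ?thesis using uv by (intro exI[of _ "[(u, v)]"]) (simp add: apath_def awalk_def)
    next
      case 3
      then show ?thesis using uv by (intro exI[of _ "[(u, z), (z, v)]"]) (simp add: apath_def awalk_def)
    qed
  qed
  then show ?thesis using diameter_le_iff[OF assms, of 2] by simp
qed

context finite_group
begin

lemma cyclic_imp_commute:
  assumes "cyclic_group (subgroup_generated G {x, y})" "x \<in> carrier G" "y \<in> carrier G"
  shows "x \<otimes> y = y \<otimes> x"
proof -
  interpret S: comm_group "subgroup_generated G {x, y}"
    using assms(1) by (rule group.cyclic_imp_abelian_group[OF group_subgroup_generated])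
  have "x \<in> carrier (subgroup_generated G {x, y})" "y \<in> carrier (subgroup_generated G {x, y})"
    using assms(2,3) by (auto simp: carrier_subgroup_generated intro: generate.incl)
  then show ?thesis using S.m_comm[of x y] by simp
qed

lemma cyclic_pairI:
  assumes "x \<in> carrier G" "y \<in> carrier G" "h \<in> generate G {x, y}" "x \<in> generate G {h}" "y \<in> generate G {h}"
  shows "cyclic_group (subgroup_generated G {x, y})"
proof -
  have sub: "subgroup (generate G {x, y}) G" using assms(1,2) by (intro generate_is_subgroup) auto
  have h: "h \<in> carrier G" using subgroup.mem_carrier[OF sub assms(3)] .
  have "generate G {x, y} = generate G {h}"
  proof
    show "generate G {x, y} \<subseteq> generate G {h}"
      using assms(4,5) by (intro generate_subgroup_incl[OF _ subgroup_generate[OF h]]) auto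
    show "generate G {h} \<subseteq> generate G {x, y}" using generate_mono_elem[OF sub assms(3)] .
  qed
  then have "subgroup_generated G {x, y} = subgroup_generated G {h}"
    using assms(1,2) h by (simp add: subgroup_generated_def Int_absorb1)
  then show ?thesis using cyclic_group_generated[of h] by simp
qed

end

context finite_Z_group
begin

text \<open>
  The subgroup is generated by the product of the two elements if their orders are coprime; otherwise a
  power of \<open>w\<close> has the order of \<open>z\<close>, and centrality turns conjugacy into \<open>z\<close> being a power of \<open>w\<close>.
\<close>
lemma cyclic_with_central_prime_order:
  assumes z: "z \<in> center G" "prime (ord z)" and w: "w \<in> carrier G"
  shows "cyclic_group (subgroup_generated G {w, z})"
proof -
  define p where "p = ord z"
  have p: "prime p" using z(2) by (simp add: p_def)
  have zG: "z \<in> carrier G" and zc: "\<And>g. g \<in> carrier G \<Longrightarrow> g \<otimes> z = z \<otimes> g"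
    using z(1) by (auto simp: center_def)
  have gen: "w \<in> generate G {w, z}" "z \<in> generate G {w, z}" by (auto intro: generate.incl)
  show ?thesis
  proof (cases "p dvd ord w")
    case False
    then have co: "coprime (ord w) (ord z)"
      using prime_imp_coprime[OF p False] by (simp add: p_def coprime_commute)
    show ?thesis
    proof (rule cyclic_pairI[OF w zG])
      show "w \<otimes> z \<in> generate G {w, z}" using generate.eng[OF gen] .
      show "w \<in> generate G {w \<otimes> z}" using left_factor_mem_generate[OF w zG zc[OF w] co] .
      show "z \<in> generate G {w \<otimes> z}"
        using left_factor_mem_generate[OF zG w zc[OF w, symmetric]] co zc[OF w] by (simp add: coprime_commute)
    qed
  next
    case True
    define w' where "w' = w [^] (ord w div p)"
    have w': "w' \<in> carrier G" using w by (simp add: w'_def)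
    have "ord w' = p" unfolding w'_def by (rule ord_pow_div[OF w True])
    then obtain h where h: "h \<in> carrier G" "conj_by h z \<in> generate G {w'}"
      using conj_into_cyclic[OF subgroup_self p zG w', of 1] by (auto simp: p_def)
    moreover have "conj_by h z = z" using zc[OF h(1)] h(1) zG by (simp add: conj_fix_iff)
    ultimately have "z \<in> generate G {w'}" by simp
    also have "\<dots> \<subseteq> generate G {w}"
      using generate_mono_elem[OF subgroup_generate[OF w]] generate_powers[OF w] by (simp add: w'_def)
    finally show ?thesis using cyclic_pairI[OF w zG gen(1) generate_self] by simp
  qed
qed

end

lemma Z_group_imp_finite_Z_group:
  assumes "Z_group G" "finite (carrier G)"
  shows "finite_Z_group G"
proof -
  interpret group G using assms(1) by (simp add: Z_group_def)
  interpret finite_group G by unfold_locales (rule assms(2))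
  show ?thesis
  proof unfold_locales
    fix p :: nat assume p: "prime p"
    have "order G = p ^ multiplicity p (order G) * (order G div p ^ multiplicity p (order G))"
      by (simp add: multiplicity_dvd)
    then obtain P where P: "subgroup P G" "card P = p ^ multiplicity p (order G)"
      using sylow_thm[OF p is_group _ assms(2)] by blast
    then have "cyclic_group (G\<lparr>carrier := P\<rparr>)"
      using assms(1) p by (auto simp: Z_group_def sylow_subgroup_def)
    then obtain g where g: "g \<in> P" "subgroup_generated (G\<lparr>carrier := P\<rparr>) {g} = G\<lparr>carrier := P\<rparr>"
      by (auto simp: cyclic_group_def)
    interpret P: group "G\<lparr>carrier := P\<rparr>" using subgroup_imp_group[OF P(1)] .
    have "P = carrier (subgroup_generated (G\<lparr>carrier := P\<rparr>) {g})" using g(2) by simp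
    also have "\<dots> = generate G {g}"
      using g(1) generate_consistent[of "{g}" P] P(1) by (simp add: carrier_subgroup_generated)
    finally have "generate G {g} = P" by simp
    then have "ord g = p ^ multiplicity p (order G)"
      using generate_pow_card[of g] P subgroup.mem_carrier[OF P(1) g(1)] by simp
    then show "\<exists>g\<in>carrier G. ord g = p ^ multiplicity p (order G)"
      using subgroup.mem_carrier[OF P(1) g(1)] by blast
  qed
qed

theorem theorem3:
  fixes G :: "('a, 'b) monoid_scheme"
  assumes "Z_group G"
    and "finite (carrier G)"
    and "\<not> trivial_group G"
  shows "diameter (with_proj (cyclic_graph G)) \<le> 2 \<longleftrightarrow> center G \<noteq> {\<one>\<^bsub>G\<^esub>}"
proof -
  interpret finite_Z_group G using assms(1,2) by (rule Z_group_imp_finite_Z_group)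
  interpret pair_graph "cyclic_graph G" using assms(2) by (rule pair_graph_cyclic_graph)
  let ?V = "carrier G - {\<one>\<^bsub>G\<^esub>}" and ?adj = "\<lambda>x y. (x, y) \<in> parcs (cyclic_graph G)"
  have diam: "diameter (with_proj (cyclic_graph G)) \<le> 2 \<longleftrightarrow>
      (\<forall>u\<in>?V. \<forall>v\<in>?V. u = v \<or> ?adj u v \<or> (\<exists>z. ?adj u z \<and> ?adj z v))"
    using diameter_le_2_iff[OF wf_digraph] by (simp add: cyclic_graph_def)
  have one: "\<one>\<^bsub>G\<^esub> \<in> center G" by (simp add: center_def)
  show ?thesis
  proof
    assume "diameter (with_proj (cyclic_graph G)) \<le> 2"
    then have conn: "u = v \<or> ?adj u v \<or> (\<exists>z. ?adj u z \<and> ?adj z v)" if "u \<in> ?V" "v \<in> ?V" for u v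
      using diam that by blast
    have commuting: "\<exists>z\<in>?V. z \<otimes>\<^bsub>G\<^esub> u = u \<otimes>\<^bsub>G\<^esub> z \<and> z \<otimes>\<^bsub>G\<^esub> v = v \<otimes>\<^bsub>G\<^esub> z"
      if uv: "u \<in> ?V" "v \<in> ?V" for u v
    proof -
      have adj: "a \<otimes>\<^bsub>G\<^esub> b = b \<otimes>\<^bsub>G\<^esub> a \<and> a \<in> ?V \<and> b \<in> ?V" if "?adj a b" for a b
        using that cyclic_imp_commute[of a b] by (auto simp: cyclic_graph_def)
      from conn[OF uv] consider "u = v" | "?adj u v" | z where "?adj u z" "?adj z v" by blast
      then show ?thesis
      proof cases
        case 1
        then show ?thesis using uv by (intro bexI[of _ u]) simp_all
      next
        case 2
        then show ?thesis using adj[of u v] uv by (intro bexI[of _ u]) simp_all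
      next
        case 3
        then show ?thesis using adj[of u z] adj[of z v] by (intro bexI[of _ z]) simp_all
      qed
    qed
    obtain x y where x: "x \<in> carrier G" and y: "y \<in> carrier G"
      and gen: "\<And>g. g \<in> carrier G \<Longrightarrow> \<exists>i j. g = x [^]\<^bsub>G\<^esub> (i::nat) \<otimes>\<^bsub>G\<^esub> y [^]\<^bsub>G\<^esub> (j::nat)"
      using two_generators by blast
    have central: "z \<in> center G"
      if z: "z \<in> carrier G" "z \<otimes>\<^bsub>G\<^esub> x = x \<otimes>\<^bsub>G\<^esub> z" "z \<otimes>\<^bsub>G\<^esub> y = y \<otimes>\<^bsub>G\<^esub> z" for z
    proof -
      have "z \<otimes>\<^bsub>G\<^esub> g = g \<otimes>\<^bsub>G\<^esub> z" if g: "g \<in> carrier G" for g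
      proof -
        obtain i j :: nat where "g = x [^]\<^bsub>G\<^esub> i \<otimes>\<^bsub>G\<^esub> y [^]\<^bsub>G\<^esub> j" using gen[OF g] by blast
        moreover have "conj_by z (x [^]\<^bsub>G\<^esub> i \<otimes>\<^bsub>G\<^esub> y [^]\<^bsub>G\<^esub> j) = x [^]\<^bsub>G\<^esub> i \<otimes>\<^bsub>G\<^esub> y [^]\<^bsub>G\<^esub> j"
          using z x y conj_fix_iff[of z x] conj_fix_iff[of z y] by (simp add: conj_mult conj_pow)
        ultimately show ?thesis using z(1) g conj_fix_iff by blast
      qed
      then show ?thesis using z(1) by (simp add: center_def)
    qed
    obtain g where g: "g \<in> ?V" using assms(3) one_closed trivial_group_subset by blast
    \<comment> \<open>If one of the generators is trivial, then any nontrivial element can stand in for it.\<close>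
    define u where "u = (if x = \<one>\<^bsub>G\<^esub> then g else x)"
    define v where "v = (if y = \<one>\<^bsub>G\<^esub> then g else y)"
    have "u \<in> ?V" "v \<in> ?V" using g x y by (auto simp: u_def v_def)
    then obtain z where z: "z \<in> ?V" "z \<otimes>\<^bsub>G\<^esub> u = u \<otimes>\<^bsub>G\<^esub> z" "z \<otimes>\<^bsub>G\<^esub> v = v \<otimes>\<^bsub>G\<^esub> z"
      using commuting by blast
    have "z \<in> center G"
    proof (rule central)
      show "z \<in> carrier G" using z(1) by blast
      then show "z \<otimes>\<^bsub>G\<^esub> x = x \<otimes>\<^bsub>G\<^esub> z" "z \<otimes>\<^bsub>G\<^esub> y = y \<otimes>\<^bsub>G\<^esub> z"
        using z(2,3) by (auto simp: u_def v_def split: if_splits)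
    qed
    then show "center G \<noteq> {\<one>\<^bsub>G\<^esub>}" using z(1) by blast
  next
    assume "center G \<noteq> {\<one>\<^bsub>G\<^esub>}"
    then obtain z0 where z0: "z0 \<in> center G" "z0 \<noteq> \<one>\<^bsub>G\<^esub>" using one by blast
    then have z0G: "z0 \<in> carrier G" by (simp add: center_def)
    have "ord z0 \<noteq> 1" using ord_eq_1[OF z0G] z0(2) by simp
    then obtain p where p: "prime p" "p dvd ord z0" using prime_factor_nat by blast
    define z where "z = z0 [^]\<^bsub>G\<^esub> (ord z0 div p)"
    have zG: "z \<in> carrier G" using z0G by (simp add: z_def)
    have "z \<in> center G"
      using z0 zG commute_pow[OF _ z0G] by (auto simp: center_def z_def)
    have "ord z = p" unfolding z_def by (rule ord_pow_div[OF z0G p(2)])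
    then have "z \<noteq> \<one>\<^bsub>G\<^esub>" using p(1) by (auto simp: not_prime_1)
    have "?adj u z \<and> ?adj z u" if "u \<in> ?V" "u \<noteq> z" for u
      using that cyclic_with_central_prime_order[OF \<open>z \<in> center G\<close>, of u] \<open>ord z = p\<close> p(1) zG \<open>z \<noteq> \<one>\<^bsub>G\<^esub>\<close>
      by (simp add: cyclic_graph_def insert_commute)
    then show "diameter (with_proj (cyclic_graph G)) \<le> 2"
      unfolding diam by metis
  qed
qed

end
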